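(* Let $X$ and $Y$ be uniformly locally finite metric spaces, $\Phi:\mathrm{C}^*_u(X)\to\mathrm{C}^*_u(Y)$ an embedding and $n\in\mathbb N\cup\{\infty\}$. The following are equivalent: (1) there is an isometric embedding $u:\ell_2(X,\mathbb C^n)\to\ell_2(Y)$ such that $\Phi=\mathrm{Ad}(u)\circ I_n$, i.e. $\Phi(a)=uI_n(a)u^*$ for all $a\in\mathrm{C}^*_u(X)$; (2) $\Phi$ is $1$-to-$n$ rank-preserving and strongly continuous.
   Context: $\mathrm{C}^*_u(X)$: norm closure in $\mathcal B(\ell_2(X))$ of finite-propagation operators. Embedding = injective $*$-homomorphism. For $n=\infty$, $\mathbb C^n$ means $\ell_2$. $I_n:\mathrm{C}^*_u(X)\to\mathrm{C}^*_u(X)\otimes\mathcal B(\mathbb C^n)\subset\mathcal B(\ell_2(X,\mathbb C^n))$ is the map $I_n([a_{xy}])=[a_{xy}\mathrm{Id}_{\mathbb C^n}]$ (matrix with entries in $\mathcal B(\mathbb C^n)$), i.e. $I_n(a)=\mathrm{SOT}\text{-}\lim_{F}\sum_{x,y\in F}a_{xy}e_{xy}\otimes\mathrm{Id}_n$ over finite $F\subset X$, where $a_{xy}=\langle a\delta_y,\delta_x\rangle$-type matrix coefficients and $e_{xy}$ the matrix units. $\Phi$ is $1$-to-$n$ rank-preserving if it sends operators of rank $1$ to operators of rank $n$. Strongly continuous: continuous for the strong operator topology on bounded sets. *)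

theory Defs
  imports "HOL-Analysis.Analysis" "HOL-Library.Extended_Nat"
begin

(* Vectors in l2(I) are functions I => complex; bounded operators l2(I) -> l2(J)
   are represented by their matrices M :: J => I => complex, M j i = <M delta_i, delta_j>. *)

definition l2 :: "('i \<Rightarrow> complex) \<Rightarrow> bool" where
  "l2 f \<longleftrightarrow> (\<lambda>i. (cmod (f i))^2) summable_on UNIV"

definition l2_norm :: "('i \<Rightarrow> complex) \<Rightarrow> real" where
  "l2_norm f = sqrt (\<Sum>\<^sub>\<infinity>i. (cmod (f i))^2)"

definition mat_apply :: "('j \<Rightarrow> 'i \<Rightarrow> complex) \<Rightarrow> ('i \<Rightarrow> complex) \<Rightarrow> ('j \<Rightarrow> complex)" where
  "mat_apply M f = (\<lambda>j. \<Sum>\<^sub>\<infinity>i. M j i * f i)"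

text \<open>The matrix defines a bounded operator (checked on the dense set of finitely supported vectors).\<close>
definition bounded_mat :: "('j \<Rightarrow> 'i \<Rightarrow> complex) \<Rightarrow> bool" where
  "bounded_mat M \<longleftrightarrow> (\<exists>C. \<forall>f. finite {i. f i \<noteq> 0} \<longrightarrow>
      l2 (mat_apply M f) \<and> l2_norm (mat_apply M f) \<le> C * l2_norm f)"

definition op_norm :: "('j \<Rightarrow> 'i \<Rightarrow> complex) \<Rightarrow> real" where
  "op_norm M = Sup {l2_norm (mat_apply M f) | f. finite {i. f i \<noteq> 0} \<and> l2_norm f \<le> 1}"

definition mat_mult :: "('k \<Rightarrow> 'j \<Rightarrow> complex) \<Rightarrow> ('j \<Rightarrow> 'i \<Rightarrow> complex) \<Rightarrow> ('k \<Rightarrow> 'i \<Rightarrow> complex)" where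
  "mat_mult A B = (\<lambda>k i. \<Sum>\<^sub>\<infinity>j. A k j * B j i)"

definition mat_adj :: "('j \<Rightarrow> 'i \<Rightarrow> complex) \<Rightarrow> ('i \<Rightarrow> 'j \<Rightarrow> complex)" where
  "mat_adj A = (\<lambda>i j. cnj (A j i))"

definition finite_propagation :: "('x::metric_space \<Rightarrow> 'x \<Rightarrow> complex) \<Rightarrow> bool" where
  "finite_propagation M \<longleftrightarrow> (\<exists>r. \<forall>x y. M x y \<noteq> 0 \<longrightarrow> dist x y \<le> r)"

definition uniform_roe :: "('x::metric_space \<Rightarrow> 'x \<Rightarrow> complex) \<Rightarrow> bool" where
  "uniform_roe M \<longleftrightarrow> bounded_mat M \<and>
     (\<forall>e>0. \<exists>N. bounded_mat N \<and> finite_propagation N \<and> op_norm (\<lambda>x y. M x y - N x y) < e)"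

definition unif_locally_finite :: "'a::metric_space itself \<Rightarrow> bool" where
  "unif_locally_finite _ \<longleftrightarrow> (\<forall>r. \<exists>N::nat. \<forall>x::'a. finite (cball x r) \<and> card (cball x r) \<le> N)"

definition roe_embedding ::
  "(('x::metric_space \<Rightarrow> 'x \<Rightarrow> complex) \<Rightarrow> ('y::metric_space \<Rightarrow> 'y \<Rightarrow> complex)) \<Rightarrow> bool" where
  "roe_embedding \<Phi> \<longleftrightarrow>
     (\<forall>a. uniform_roe a \<longrightarrow> uniform_roe (\<Phi> a)) \<and>
     (\<forall>a b. uniform_roe a \<and> uniform_roe b \<longrightarrow> \<Phi> (\<lambda>x y. a x y + b x y) = (\<lambda>x y. \<Phi> a x y + \<Phi> b x y)) \<and>
     (\<forall>a c. uniform_roe a \<longrightarrow> \<Phi> (\<lambda>x y. c * a x y) = (\<lambda>x y. c * \<Phi> a x y)) \<and>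
     (\<forall>a b. uniform_roe a \<and> uniform_roe b \<longrightarrow> \<Phi> (mat_mult a b) = mat_mult (\<Phi> a) (\<Phi> b)) \<and>
     (\<forall>a. uniform_roe a \<longrightarrow> \<Phi> (mat_adj a) = mat_adj (\<Phi> a)) \<and>
     inj_on \<Phi> {a. uniform_roe a}"

text \<open>The amplification I_n, with C^n modelled as l2('k).\<close>
definition amplify :: "('x \<Rightarrow> 'x \<Rightarrow> complex) \<Rightarrow> ('x \<times> 'k) \<Rightarrow> ('x \<times> 'k) \<Rightarrow> complex" where
  "amplify a = (\<lambda>(x, k) (y, l). if k = l then a x y else 0)"

definition isometry_mat :: "('j \<Rightarrow> 'i \<Rightarrow> complex) \<Rightarrow> bool" where
  "isometry_mat U \<longleftrightarrow> bounded_mat U \<and>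
     (\<forall>f. l2 f \<longrightarrow> l2 (mat_apply U f) \<and> l2_norm (mat_apply U f) = l2_norm f)"

definition lin_indep_vecs :: "(nat \<Rightarrow> 'j \<Rightarrow> complex) \<Rightarrow> nat \<Rightarrow> bool" where
  "lin_indep_vecs v k \<longleftrightarrow>
     (\<forall>c::nat \<Rightarrow> complex. (\<forall>j. (\<Sum>m<k. c m * v m j) = 0) \<longrightarrow> (\<forall>m<k. c m = 0))"

definition rank_at_least :: "('j \<Rightarrow> 'i \<Rightarrow> complex) \<Rightarrow> nat \<Rightarrow> bool" where
  "rank_at_least M k \<longleftrightarrow>
     (\<exists>v. (\<forall>m<k. l2 (v m)) \<and> lin_indep_vecs (\<lambda>m. mat_apply M (v m)) k)"

definition has_rank :: "('j \<Rightarrow> 'i \<Rightarrow> complex) \<Rightarrow> enat \<Rightarrow> bool" where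
  "has_rank M n \<longleftrightarrow> (\<forall>k. enat k \<le> n \<longleftrightarrow> rank_at_least M k)"

definition rank_preserving_1_to ::
  "(('x::metric_space \<Rightarrow> 'x \<Rightarrow> complex) \<Rightarrow> ('y \<Rightarrow> 'y \<Rightarrow> complex)) \<Rightarrow> enat \<Rightarrow> bool" where
  "rank_preserving_1_to \<Phi> n \<longleftrightarrow> (\<forall>a. uniform_roe a \<and> has_rank a 1 \<longrightarrow> has_rank (\<Phi> a) n)"

text \<open>Continuity for the strong operator topology on each bounded subset of C*_u(X)
  (neighbourhood formulation).\<close>
definition strongly_continuous ::
  "(('x::metric_space \<Rightarrow> 'x \<Rightarrow> complex) \<Rightarrow> ('y \<Rightarrow> 'y \<Rightarrow> complex)) \<Rightarrow> bool" where
  "strongly_continuous \<Phi> \<longleftrightarrow>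
    (\<forall>C a f \<epsilon>. uniform_roe a \<and> op_norm a \<le> C \<and> l2 f \<and> \<epsilon> > 0 \<longrightarrow>
      (\<exists>G \<delta>. finite G \<and> (\<forall>g\<in>G. l2 g) \<and> \<delta> > 0 \<and>
        (\<forall>b. uniform_roe b \<and> op_norm b \<le> C \<and>
             (\<forall>g\<in>G. l2_norm (\<lambda>x. mat_apply b g x - mat_apply a g x) < \<delta>) \<longrightarrow>
             l2_norm (\<lambda>y. mat_apply (\<Phi> b) f y - mat_apply (\<Phi> a) f y) < \<epsilon>)))"

end

theory Submission
  imports Defs
begin

text \<open>
  For an isometry $U$, the map $a \mapsto U I_n(a) U^*$ multiplies ranks by $n$, because $U^*$ is onto and
  $I_n(\xi \otimes \eta^*)$ has range $\xi \otimes \mathbb{C}^n$. It is strongly continuous on bounded sets,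
  because $U^* f$ is approximated by finitely supported vectors.

  Conversely, fix a base point $b$. The projection $\Phi(e_{bb})$ has rank $n$, so its range has an orthonormal
  basis $(w_k)$ indexed by $n$, and the vectors $\Phi(e_{xb}) w_k$ are the columns of an isometry $U$ with
  $\Phi(e_{xy}) = U I_n(e_{xy}) U^*$. Both sides of $\Phi(a) = U I_n(a) U^*$ are linear and strongly continuous
  on bounded sets, and every $a$ is the strong limit of its finite corners, whose norms are at most that of $a$.
\<close>

section \<open>Square-summable vectors\<close>

text \<open>The rank hypothesis counts finite independent families and supplies no basis. Local
  finiteness makes both spaces countable, so the vectors
  \<open>mat_apply (\<Phi> (mat_unit b x)) (unit_vec y)\<close> can be listed in a sequence.
  Gram-Schmidt turns it into a sequence of orthonormal or zero vectors. The entries of every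
  \<open>\<Phi> (mat_unit x y)\<close> are inner products of members of the original sequence, so
  the expansions that have to be justified are finite. One base point serves all of
  \<open>'x\<close>, because \<open>\<Phi> (mat_unit x b)\<close> carries the range of
  \<open>\<Phi> (mat_unit b b)\<close> isometrically onto that of
  \<open>\<Phi> (mat_unit x x)\<close>. The rank then tells how many nonzero vectors there are,
  which is what allows them to be indexed by \<open>'k\<close>.

  A second obstacle is the matrix model. Boundedness is tested on finitely supported vectors, and
  \<open>infsum\<close> is 0 on divergent families, so series identities have to wait until rows are
  known to lie in l2. Adjoints and products are then treated through inner products, which replaces
  the interchange of double series.\<close>

definition trunc :: "'i set \<Rightarrow> ('i \<Rightarrow> complex) \<Rightarrow> 'i \<Rightarrow> complex" where
  "trunc F f = (\<lambda>i. if i \<in> F then f i else 0)"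

definition unit_vec :: "'i \<Rightarrow> 'i \<Rightarrow> complex" where
  "unit_vec i = (\<lambda>j. if j = i then 1 else 0)"

text \<open>Conjugate-linear in the first argument, so that applying a matrix to \<open>f\<close>
  means pairing its conjugated rows with \<open>f\<close>.\<close>

definition cip :: "('i \<Rightarrow> complex) \<Rightarrow> ('i \<Rightarrow> complex) \<Rightarrow> complex" where
  "cip f g = (\<Sum>\<^sub>\<infinity>i. cnj (f i) * g i)"

lemma L2_set_le_l2_norm:
  assumes "l2 f" "finite F"
  shows "L2_set (\<lambda>i. cmod (f i)) F \<le> l2_norm f"
  unfolding L2_set_def l2_norm_def
  by (intro real_sqrt_le_mono finite_sum_le_infsum) (use assms in \<open>auto simp: l2_def\<close>)

lemma l2_norm_nonneg [simp]: "0 \<le> l2_norm f"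
  unfolding l2_norm_def by (intro real_sqrt_ge_zero infsum_nonneg) auto

text \<open>The sum of squares is the supremum of its finite partial sums, so a uniform bound on
  finite pieces gives membership and norm at once. Many of the l2 estimates below reduce to finite
  sums in this way.\<close>

lemma l2_bounded_sums:
  assumes "\<And>F. finite F \<Longrightarrow> L2_set (\<lambda>i. cmod (f i)) F \<le> C"
  shows "l2 f" "l2_norm f \<le> C"
proof -
  have C0: "0 \<le> C" using assms[of "{}"] by simp
  have b: "(\<Sum>i\<in>F. (cmod (f i))\<^sup>2) \<le> C\<^sup>2" if "finite F" for F
  proof -
    have "(\<Sum>i\<in>F. (cmod (f i))\<^sup>2) = (L2_set (\<lambda>i. cmod (f i)) F)\<^sup>2"
      unfolding L2_set_def by (simp add: sum_nonneg)
    also have "\<dots> \<le> C\<^sup>2" by (intro power_mono assms that) simp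
    finally show ?thesis .
  qed
  show s: "l2 f" unfolding l2_def
    by (rule nonneg_bdd_above_summable_on) (auto intro!: bdd_aboveI[where M="C\<^sup>2"] b)
  have "(\<Sum>\<^sub>\<infinity>i. (cmod (f i))\<^sup>2) \<le> C\<^sup>2"
    by (rule infsum_le_finite_sums) (use s b in \<open>auto simp: l2_def\<close>)
  then show "l2_norm f \<le> C"
    unfolding l2_norm_def using C0 real_le_lsqrt real_sqrt_le_iff by (metis real_sqrt_abs abs_of_nonneg)
qed

lemma l2_norm_power2: "(l2_norm f)\<^sup>2 = (\<Sum>\<^sub>\<infinity>i. (cmod (f i))\<^sup>2)"
  unfolding l2_norm_def by (simp add: infsum_nonneg)

lemma l2_norm_finite_support:
  assumes "finite F" "\<And>i. i \<notin> F \<Longrightarrow> f i = 0"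
  shows "l2 f" "l2_norm f = L2_set (\<lambda>i. cmod (f i)) F"
proof -
  have "((\<lambda>i. (cmod (f i))\<^sup>2) has_sum (\<Sum>i\<in>F. (cmod (f i))\<^sup>2)) F"
    using assms(1) by (rule has_sum_finite)
  then have "((\<lambda>i. (cmod (f i))\<^sup>2) has_sum (\<Sum>i\<in>F. (cmod (f i))\<^sup>2)) UNIV"
    by (subst has_sum_cong_neutral[where T=F and g="\<lambda>i. (cmod (f i))\<^sup>2"]) (use assms in auto)
  then show "l2 f" "l2_norm f = L2_set (\<lambda>i. cmod (f i)) F"
    unfolding l2_def l2_norm_def L2_set_def by (auto simp: infsumI summable_on_def)
qed

lemma l2_trunc [simp]: "finite F \<Longrightarrow> l2 (trunc F f)"
  by (rule l2_norm_finite_support(1)[of F]) (auto simp: trunc_def)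

lemma l2_norm_trunc: "finite F \<Longrightarrow> l2_norm (trunc F f) = L2_set (\<lambda>i. cmod (f i)) F"
  by (subst l2_norm_finite_support(2)[of F]) (auto simp: trunc_def intro!: L2_set_cong)

lemma l2_norm_trunc_le: "finite F \<Longrightarrow> l2 f \<Longrightarrow> l2_norm (trunc F f) \<le> l2_norm f"
  by (simp add: l2_norm_trunc L2_set_le_l2_norm)

lemma l2_unit_vec [simp]: "l2 (unit_vec i)"
  by (rule l2_norm_finite_support(1)[of "{i}"]) (auto simp: unit_vec_def)

lemma l2_norm_unit_vec [simp]: "l2_norm (unit_vec i) = 1"
  by (subst l2_norm_finite_support(2)[of "{i}"]) (auto simp: unit_vec_def L2_set_def)

lemma l2_zero [simp]: "l2 (\<lambda>i. 0)" and l2_norm_zero [simp]: "l2_norm (\<lambda>i. 0) = 0"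
  using l2_norm_finite_support[of "{}" "\<lambda>i. 0"] by auto

lemma norm_le_l2_norm: "l2 f \<Longrightarrow> cmod (f i) \<le> l2_norm f"
  using L2_set_le_l2_norm[of f "{i}"] by (simp add: L2_set_def)

lemma l2_norm_eq_0_iff: "l2 f \<Longrightarrow> l2_norm f = 0 \<longleftrightarrow> f = (\<lambda>i. 0)"
  using norm_le_l2_norm[of f] by fastforce

lemma l2_scale:
  assumes "l2 f"
  shows "l2 (\<lambda>i. c * f i)" "l2_norm (\<lambda>i. c * f i) = cmod c * l2_norm f"
  using assms unfolding l2_def l2_norm_def
  by (auto simp: norm_mult power_mult_distrib summable_on_cmult_right infsum_cmult_right real_sqrt_mult)

lemma l2_add:
  assumes "l2 f" "l2 g"
  shows "l2 (\<lambda>i. f i + g i)" "l2_norm (\<lambda>i. f i + g i) \<le> l2_norm f + l2_norm g"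
proof -
  have "L2_set (\<lambda>i. cmod (f i + g i)) F \<le> l2_norm f + l2_norm g" if "finite F" for F
  proof -
    have "L2_set (\<lambda>i. cmod (f i + g i)) F \<le> L2_set (\<lambda>i. cmod (f i) + cmod (g i)) F"
      by (intro L2_set_mono) (auto intro: norm_triangle_ineq)
    also have "\<dots> \<le> L2_set (\<lambda>i. cmod (f i)) F + L2_set (\<lambda>i. cmod (g i)) F"
      by (rule L2_set_triangle_ineq)
    also have "\<dots> \<le> l2_norm f + l2_norm g"
      by (intro add_mono L2_set_le_l2_norm assms that)
    finally show ?thesis .
  qed
  from l2_bounded_sums[OF this]
  show "l2 (\<lambda>i. f i + g i)" "l2_norm (\<lambda>i. f i + g i) \<le> l2_norm f + l2_norm g" by auto
qed

lemma l2_diff: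
  assumes "l2 f" "l2 g"
  shows "l2 (\<lambda>i. f i - g i)" "l2_norm (\<lambda>i. f i - g i) \<le> l2_norm f + l2_norm g"
  using l2_add[OF assms(1) l2_scale(1)[OF assms(2), of "-1"]] l2_scale(2)[OF assms(2), of "-1"] by auto

lemma l2_sum:
  assumes "\<And>m. m \<in> A \<Longrightarrow> l2 (f m)"
  shows "l2 (\<lambda>i. \<Sum>m\<in>A. f m i)"
    and "l2_norm (\<lambda>i. \<Sum>m\<in>A. f m i) \<le> (\<Sum>m\<in>A. l2_norm (f m))"
proof -
  have "l2 (\<lambda>i. \<Sum>m\<in>A. f m i) \<and> l2_norm (\<lambda>i. \<Sum>m\<in>A. f m i) \<le> (\<Sum>m\<in>A. l2_norm (f m))"
    using assms
  proof (induction A rule: infinite_finite_induct)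
    case (insert a A)
    then show ?case
      using l2_add[of "f a" "\<lambda>i. \<Sum>m\<in>A. f m i"] by force
  qed auto
  then show "l2 (\<lambda>i. \<Sum>m\<in>A. f m i)" "l2_norm (\<lambda>i. \<Sum>m\<in>A. f m i) \<le> (\<Sum>m\<in>A. l2_norm (f m))" by auto
qed

lemma l2_lincomb: "(\<And>m. m \<in> A \<Longrightarrow> l2 (f m)) \<Longrightarrow> l2 (\<lambda>i. \<Sum>m\<in>A. c m * f m i)"
  by (intro l2_sum(1) l2_scale(1))

lemma l2_cnj [simp]: "l2 (\<lambda>i. cnj (f i)) \<longleftrightarrow> l2 f"
  unfolding l2_def by simp

lemma l2_norm_cnj [simp]: "l2_norm (\<lambda>i. cnj (f i)) = l2_norm f"
  unfolding l2_norm_def by simp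

section \<open>Cauchy-Schwarz and the inner product\<close>

lemma l2_mult_sum_le:
  assumes "l2 f" "l2 g" "finite F"
  shows "(\<Sum>i\<in>F. cmod (f i * g i)) \<le> l2_norm f * l2_norm g"
proof -
  have "(\<Sum>i\<in>F. cmod (f i * g i)) = (\<Sum>i\<in>F. \<bar>cmod (f i)\<bar> * \<bar>cmod (g i)\<bar>)" by (simp add: norm_mult)
  also have "\<dots> \<le> L2_set (\<lambda>i. cmod (f i)) F * L2_set (\<lambda>i. cmod (g i)) F" by (rule L2_set_mult_ineq)
  also have "\<dots> \<le> l2_norm f * l2_norm g"
    by (intro mult_mono L2_set_le_l2_norm assms) auto
  finally show ?thesis .
qed

lemma l2_mult_abs_summable:
  assumes "l2 f" "l2 g"
  shows "(\<lambda>i. norm (f i * g i)) summable_on UNIV"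
  by (rule nonneg_bdd_above_summable_on)
    (auto intro!: bdd_aboveI[where M="l2_norm f * l2_norm g"] l2_mult_sum_le assms)

lemma l2_mult_summable: "l2 f \<Longrightarrow> l2 g \<Longrightarrow> (\<lambda>i. f i * g i) summable_on UNIV"
  by (rule abs_summable_summable[OF l2_mult_abs_summable])

lemma norm_infsum_mult_le:
  assumes "l2 f" "l2 g"
  shows "cmod (\<Sum>\<^sub>\<infinity>i. f i * g i) \<le> l2_norm f * l2_norm g"
proof -
  have "cmod (\<Sum>\<^sub>\<infinity>i. f i * g i) \<le> (\<Sum>\<^sub>\<infinity>i. cmod (f i * g i))"
    by (intro norm_infsum_bound l2_mult_abs_summable assms)
  also have "\<dots> \<le> l2_norm f * l2_norm g"
    by (intro infsum_le_finite_sums l2_mult_sum_le l2_mult_abs_summable assms)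
  finally show ?thesis .
qed

lemma cip_summable: "l2 f \<Longrightarrow> l2 g \<Longrightarrow> (\<lambda>i. cnj (f i) * g i) summable_on UNIV"
  by (intro l2_mult_summable) auto

lemma cip_bound: "l2 f \<Longrightarrow> l2 g \<Longrightarrow> cmod (cip f g) \<le> l2_norm f * l2_norm g"
  unfolding cip_def using norm_infsum_mult_le[of "\<lambda>i. cnj (f i)" g] by simp

text \<open>Unrestricted in \<open>f\<close> and \<open>g\<close>: conjugation preserves
  convergence, and a divergent series has \<open>infsum\<close> 0 on both sides.\<close>

lemma cip_commute: "cip g f = cnj (cip f g)"
  unfolding cip_def infsum_cnj[symmetric] by (simp add: mult.commute)

lemma cip_add_right: "l2 f \<Longrightarrow> l2 g \<Longrightarrow> l2 h \<Longrightarrow> cip f (\<lambda>i. g i + h i) = cip f g + cip f h"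
  unfolding cip_def by (simp add: distrib_left infsum_add cip_summable)

lemma cip_scale_right: "cip f (\<lambda>i. c * g i) = c * cip f g"
  unfolding cip_def by (simp add: infsum_cmult_right' mult.left_commute)

lemma cip_add_left: "l2 f \<Longrightarrow> l2 g \<Longrightarrow> l2 h \<Longrightarrow> cip (\<lambda>i. g i + h i) f = cip g f + cip h f"
  by (subst (1 2 3) cip_commute) (simp add: cip_add_right)

lemma cip_diff_right: "l2 f \<Longrightarrow> l2 g \<Longrightarrow> l2 h \<Longrightarrow> cip f (\<lambda>i. g i - h i) = cip f g - cip f h"
  using cip_add_right[of f g "\<lambda>i. -1 * h i"] cip_scale_right[of f "-1" h] l2_scale(1)[of h "-1"] by auto

lemma cip_diff_left: "l2 f \<Longrightarrow> l2 g \<Longrightarrow> l2 h \<Longrightarrow> cip (\<lambda>i. g i - h i) f = cip g f - cip h f"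
  by (subst (1 2 3) cip_commute) (simp add: cip_diff_right)

lemma cip_zero_right [simp]: "cip f (\<lambda>i. 0) = 0" and cip_zero_left [simp]: "cip (\<lambda>i. 0) f = 0"
  unfolding cip_def by auto

lemma cip_lincomb_right:
  assumes "l2 f" "\<And>m. m \<in> A \<Longrightarrow> l2 (g m)"
  shows "cip f (\<lambda>i. \<Sum>m\<in>A. c m * g m i) = (\<Sum>m\<in>A. c m * cip f (g m))"
  using assms(2)
proof (induction A rule: infinite_finite_induct)
  case (insert a A)
  then have "cip f (\<lambda>i. c a * g a i + (\<Sum>m\<in>A. c m * g m i)) =
      cip f (\<lambda>i. c a * g a i) + cip f (\<lambda>i. \<Sum>m\<in>A. c m * g m i)"
    by (intro cip_add_right assms(1) l2_scale l2_lincomb) auto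
  with insert show ?case by (simp add: cip_scale_right)
qed auto

lemma cip_lincomb_left:
  assumes "l2 f" "\<And>m. m \<in> A \<Longrightarrow> l2 (g m)"
  shows "cip (\<lambda>i. \<Sum>m\<in>A. c m * g m i) f = (\<Sum>m\<in>A. cnj (c m) * cip (g m) f)"
  by (subst (1 2) cip_commute) (simp add: cip_lincomb_right assms)

lemma cip_same: "l2 f \<Longrightarrow> cip f f = of_real ((l2_norm f)\<^sup>2)"
proof -
  assume "l2 f"
  have "cip f f = (\<Sum>\<^sub>\<infinity>i. of_real ((cmod (f i))\<^sup>2))"
    unfolding cip_def by (intro infsum_cong) (simp add: complex_norm_square mult.commute del: of_real_power)
  also have "\<dots> = of_real (\<Sum>\<^sub>\<infinity>i. (cmod (f i))\<^sup>2)" 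
    by (rule infsumI, subst has_sum_of_real_iff) (use \<open>l2 f\<close> in \<open>simp add: l2_def\<close>)
  finally show ?thesis by (simp add: l2_norm_power2)
qed

lemma cip_finite_support:
  assumes "finite F" "\<And>i. i \<notin> F \<Longrightarrow> f i = 0"
  shows "cip f g = (\<Sum>i\<in>F. cnj (f i) * g i)"
  unfolding cip_def
  by (subst infsum_cong_neutral[where T=F and g="\<lambda>i. cnj (f i) * g i"]) (use assms in auto)

lemma cip_unit_vec [simp]: "cip (unit_vec i) f = f i" "cip f (unit_vec i) = cnj (f i)"
proof -
  show *: "cip (unit_vec i) f = f i" for f
    by (subst cip_finite_support[of "{i}"]) (auto simp: unit_vec_def)
  show "cip f (unit_vec i) = cnj (f i)" by (subst cip_commute) (simp add: *)
qed

text \<open>Truncation and remainder have disjoint supports, so the squared norm of the remainder is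
  the total minus the partial sum over \<open>F\<close>, and partial sums converge to the
  total.\<close>

lemma eventually_trunc_close:
  assumes "l2 f" "\<epsilon> > 0"
  shows "\<forall>\<^sub>F F in finite_subsets_at_top UNIV. l2_norm (\<lambda>i. f i - trunc F f i) < \<epsilon>"
proof -
  define S where "S = (\<Sum>\<^sub>\<infinity>i. (cmod (f i))\<^sup>2)"
  have "((\<lambda>i. (cmod (f i))\<^sup>2) has_sum S) UNIV"
    using assms(1) unfolding S_def l2_def by simp
  then have "((\<lambda>F. \<Sum>i\<in>F. (cmod (f i))\<^sup>2) \<longlongrightarrow> S) (finite_subsets_at_top UNIV)"
    unfolding has_sum_def by simp
  moreover have "S - \<epsilon>\<^sup>2 < S" using assms by simp
  ultimately have "\<forall>\<^sub>F F in finite_subsets_at_top UNIV. S - \<epsilon>\<^sup>2 < (\<Sum>i\<in>F. (cmod (f i))\<^sup>2)"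
    by (rule order_tendstoD(1))
  moreover have "\<forall>\<^sub>F F in finite_subsets_at_top (UNIV::'a set). finite F"
    by (auto simp: eventually_finite_subsets_at_top)
  ultimately show ?thesis
  proof eventually_elim
    case (elim F)
    have t: "l2 (\<lambda>i. f i - trunc F f i)" using elim assms by (intro l2_diff) auto
    have sF: "(\<Sum>\<^sub>\<infinity>i. (cmod (trunc F f i))\<^sup>2) = (\<Sum>i\<in>F. (cmod (f i))\<^sup>2)"
      unfolding l2_norm_power2[symmetric] using elim by (simp add: l2_norm_trunc L2_set_def sum_nonneg)
    have "(\<lambda>i. (cmod (f i))\<^sup>2) = (\<lambda>i. (cmod (trunc F f i))\<^sup>2 + (cmod (f i - trunc F f i))\<^sup>2)"
      by (auto simp: trunc_def)
    then have "S = (\<Sum>\<^sub>\<infinity>i. (cmod (trunc F f i))\<^sup>2) + (\<Sum>\<^sub>\<infinity>i. (cmod (f i - trunc F f i))\<^sup>2)"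
      unfolding S_def using t l2_trunc[of F f] elim by (simp add: infsum_add l2_def)
    then have "(l2_norm (\<lambda>i. f i - trunc F f i))\<^sup>2 < \<epsilon>\<^sup>2"
      using elim sF by (simp add: l2_norm_power2)
    then show ?case using assms(2) by (simp add: power_less_imp_less_base)
  qed
qed

lemma obtain_trunc_close:
  assumes "l2 f" "\<epsilon> > 0"
  obtains F where "finite F" "l2_norm (\<lambda>i. f i - trunc F f i) < \<epsilon>"
  using eventually_trunc_close[OF assms] unfolding eventually_finite_subsets_at_top by blast

section \<open>Bounded matrices as operators\<close>

lemma mat_apply_finite_support:
  assumes "finite F" "\<And>i. i \<notin> F \<Longrightarrow> f i = 0"
  shows "mat_apply M f j = (\<Sum>i\<in>F. M j i * f i)"
  unfolding mat_apply_def
  by (subst infsum_cong_neutral[where T=F and g="\<lambda>i. M j i * f i"]) (use assms in auto)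

lemma mat_apply_unit_vec [simp]: "mat_apply M (unit_vec i) = (\<lambda>j. M j i)"
  by (rule ext, subst mat_apply_finite_support[of "{i}"]) (auto simp: unit_vec_def)

lemma mat_apply_zero [simp]: "mat_apply M (\<lambda>i. 0) = (\<lambda>j. 0)"
  by (simp add: mat_apply_def)

text \<open>\<open>bounded_mat\<close> and \<open>op_norm\<close> test finitely supported vectors.
  This variant tests all of l2, as composition requires: \<open>mat_apply B f\<close> rarely has
  finite support.\<close>

definition mat_bound :: "('j \<Rightarrow> 'i \<Rightarrow> complex) \<Rightarrow> real \<Rightarrow> bool" where
  "mat_bound M C \<longleftrightarrow> (\<forall>f. l2 f \<longrightarrow> l2 (mat_apply M f) \<and> l2_norm (mat_apply M f) \<le> C * l2_norm f)"

lemma bound_nonneg: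
  fixes M :: "'j \<Rightarrow> 'i \<Rightarrow> complex"
  assumes "\<And>f. finite {i. f i \<noteq> 0} \<Longrightarrow> l2 (mat_apply M f) \<and> l2_norm (mat_apply M f) \<le> C * l2_norm f"
  shows "0 \<le> C"
proof -
  \<comment> \<open>Types are nonempty, so there is always a test vector of norm 1.\<close>
  have "finite {i. unit_vec undefined i \<noteq> 0}" by (simp add: unit_vec_def)
  from assms[OF this] have "l2_norm (mat_apply M (unit_vec undefined)) \<le> C"
    by (simp del: mat_apply_unit_vec)
  with l2_norm_nonneg show ?thesis by (rule order_trans)
qed

text \<open>The test vector is the conjugated row cut down to \<open>F\<close>. Its norm is
  \<open>s\<close>, while entry \<open>j\<close> of its image is the square of \<open>s\<close>, so
  the bound forces \<open>s\<close> below \<open>C\<close>. Square-summable rows are what makes the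
  series in \<open>mat_apply\<close> converge on all of l2.\<close>

lemma row_l2_of_bound:
  fixes M :: "'j \<Rightarrow> 'i \<Rightarrow> complex"
  assumes "\<And>f. finite {i. f i \<noteq> 0} \<Longrightarrow> l2 (mat_apply M f) \<and> l2_norm (mat_apply M f) \<le> C * l2_norm f"
  shows "l2 (M j)"
proof (rule l2_bounded_sums(1)[where C="C"])
  fix F :: "'i set" assume F: "finite F"
  define f where "f = trunc F (\<lambda>i. cnj (M j i))"
  define s where "s = L2_set (\<lambda>i. cmod (M j i)) F"
  have fin: "finite {i. f i \<noteq> 0}"
    by (rule finite_subset[OF _ F]) (auto simp: f_def trunc_def)
  have nf: "l2_norm f = s" unfolding f_def s_def using F by (simp add: l2_norm_trunc)
  have "mat_apply M f j = (\<Sum>i\<in>F. M j i * f i)"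
    by (rule mat_apply_finite_support[OF F]) (auto simp: f_def trunc_def)
  also have "\<dots> = of_real (\<Sum>i\<in>F. (cmod (M j i))\<^sup>2)"
    unfolding of_real_sum by (intro sum.cong) (auto simp: f_def trunc_def complex_norm_square simp del: of_real_power)
  also have "(\<Sum>i\<in>F. (cmod (M j i))\<^sup>2) = s\<^sup>2" unfolding s_def L2_set_def by (simp add: sum_nonneg)
  finally have "cmod (mat_apply M f j) = s\<^sup>2" by (simp add: norm_power)
  then have "s\<^sup>2 \<le> C * s" using norm_le_l2_norm[of "mat_apply M f" j] assms[OF fin] nf by auto
  moreover have "0 \<le> C" using assms by (rule bound_nonneg)
  moreover have "0 \<le> s" by (simp add: s_def)
  ultimately show "s \<le> C" by (cases "s = 0") (auto simp: power2_eq_square)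
qed

text \<open>Truncations of \<open>f\<close> converge to \<open>f\<close> and their images converge
  entrywise, since rows are in l2. On a finite set \<open>J\<close> of entries the bound survives
  the limit, and \<open>J\<close> is arbitrary.\<close>

lemma mat_boundI_finite:
  fixes M :: "'j \<Rightarrow> 'i \<Rightarrow> complex"
  assumes "\<And>f. finite {i. f i \<noteq> 0} \<Longrightarrow> l2 (mat_apply M f) \<and> l2_norm (mat_apply M f) \<le> C * l2_norm f"
  shows "mat_bound M C"
  unfolding mat_bound_def
proof (intro allI impI)
  fix f :: "'i \<Rightarrow> complex" assume f: "l2 f"
  have C0: "0 \<le> C" using assms by (rule bound_nonneg)
  have conv: "((\<lambda>F. mat_apply M (trunc F f) j) \<longlongrightarrow> mat_apply M f j) (finite_subsets_at_top UNIV)" for j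
  proof -
    have "((\<lambda>i. M j i * f i) has_sum mat_apply M f j) UNIV"
      unfolding mat_apply_def
      by (rule has_sum_infsum, rule l2_mult_summable[OF row_l2_of_bound f]) (rule assms)
    then have *: "((\<lambda>F. \<Sum>i\<in>F. M j i * f i) \<longlongrightarrow> mat_apply M f j) (finite_subsets_at_top UNIV)"
      unfolding has_sum_def .
    show ?thesis
    proof (rule Lim_transform_eventually[OF *])
      have "(\<Sum>i\<in>F. M j i * f i) = mat_apply M (trunc F f) j" if "finite F" for F
        by (subst mat_apply_finite_support[OF that]) (auto simp: trunc_def intro!: sum.cong)
      then show "\<forall>\<^sub>F F in finite_subsets_at_top UNIV. (\<Sum>i\<in>F. M j i * f i) = mat_apply M (trunc F f) j"
        unfolding eventually_finite_subsets_at_top by (intro exI[of _ "{}"]) auto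
    qed
  qed
  have "L2_set (\<lambda>j. cmod (mat_apply M f j)) J \<le> C * l2_norm f" if J: "finite J" for J
  proof (rule tendsto_upperbound)
    show "((\<lambda>F. L2_set (\<lambda>j. cmod (mat_apply M (trunc F f) j)) J) \<longlongrightarrow> L2_set (\<lambda>j. cmod (mat_apply M f j)) J)
        (finite_subsets_at_top UNIV)"
      unfolding L2_set_def by (intro tendsto_intros conv)
    show "\<forall>\<^sub>F F in finite_subsets_at_top UNIV. L2_set (\<lambda>j. cmod (mat_apply M (trunc F f) j)) J \<le> C * l2_norm f"
      unfolding eventually_finite_subsets_at_top
    proof (intro exI[of _ "{}"] conjI allI impI)
      fix F :: "'i set" assume "finite F \<and> {} \<subseteq> F \<and> F \<subseteq> UNIV"
      then have F: "finite F" by simp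
      have fin: "finite {i. trunc F f i \<noteq> 0}"
        by (rule finite_subset[OF _ F]) (auto simp: trunc_def)
      have "L2_set (\<lambda>j. cmod (mat_apply M (trunc F f) j)) J \<le> l2_norm (mat_apply M (trunc F f))"
        using assms[OF fin] J by (intro L2_set_le_l2_norm) auto
      also have "\<dots> \<le> C * l2_norm (trunc F f)" using assms[OF fin] by simp
      also have "\<dots> \<le> C * l2_norm f" by (intro mult_left_mono l2_norm_trunc_le F f C0)
      finally show "L2_set (\<lambda>j. cmod (mat_apply M (trunc F f) j)) J \<le> C * l2_norm f" .
    qed auto
  qed auto
  from l2_bounded_sums[OF this]
  show "l2 (mat_apply M f) \<and> l2_norm (mat_apply M f) \<le> C * l2_norm f" by blast
qed

lemma mat_bound_imp_bounded_mat: "mat_bound M C \<Longrightarrow> bounded_mat M"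
  unfolding bounded_mat_def mat_bound_def
  by (intro exI[of _ C] allI impI) (metis (mono_tags, lifting) l2_norm_finite_support(1) mem_Collect_eq)

lemma bounded_mat_iff: "bounded_mat M \<longleftrightarrow> (\<exists>C. mat_bound M C)"
proof
  assume "bounded_mat M"
  then obtain C where "\<And>f. finite {i. f i \<noteq> 0} \<Longrightarrow> l2 (mat_apply M f) \<and> l2_norm (mat_apply M f) \<le> C * l2_norm f"
    unfolding bounded_mat_def by blast
  then have "mat_bound M C" by (rule mat_boundI_finite)
  then show "\<exists>C. mat_bound M C" ..
qed (auto intro: mat_bound_imp_bounded_mat)

lemma mat_bound_nonneg:
  assumes "mat_bound M C" shows "0 \<le> C"
proof -
  have "l2_norm (mat_apply M (unit_vec undefined)) \<le> C"
    using assms[unfolded mat_bound_def, rule_format, OF l2_unit_vec[of undefined]]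
    by (simp del: mat_apply_unit_vec)
  with l2_norm_nonneg show ?thesis by (rule order_trans)
qed

lemma op_norm_le:
  assumes "mat_bound M C" shows "op_norm M \<le> C"
  unfolding op_norm_def
proof (rule cSup_least)
  show "{l2_norm (mat_apply M f) |f. finite {i. f i \<noteq> 0} \<and> l2_norm f \<le> 1} \<noteq> {}"
    by (auto intro!: exI[of _ "\<lambda>i. 0"])
  fix t assume "t \<in> {l2_norm (mat_apply M f) |f. finite {i. f i \<noteq> 0} \<and> l2_norm f \<le> 1}"
  then obtain f where f: "t = l2_norm (mat_apply M f)" "finite {i. f i \<noteq> 0}" "l2_norm f \<le> 1" by blast
  have "l2 f" using f(2) by (rule l2_norm_finite_support) auto
  then have "t \<le> C * l2_norm f" using assms f by (auto simp: mat_bound_def)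
  also have "\<dots> \<le> C" using f mat_bound_nonneg[OF assms] by (simp add: mult_left_le)
  finally show "t \<le> C" .
qed

text \<open>Any bound \<open>C\<close> keeps the set in \<open>op_norm\<close> bounded above, so its
  supremum is genuine; rescaling a nonzero vector to norm 1 then makes the supremum itself a
  bound.\<close>

lemma mat_bound_op_norm:
  assumes "bounded_mat M" shows "mat_bound M (op_norm M)"
proof (rule mat_boundI_finite)
  obtain C where C: "mat_bound M C" using assms bounded_mat_iff by blast
  fix f :: "'b \<Rightarrow> complex" assume fin: "finite {i. f i \<noteq> 0}"
  have f: "l2 f" using fin by (rule l2_norm_finite_support) auto
  have Mf: "l2 (mat_apply M f)" using C f by (auto simp: mat_bound_def)
  have "l2_norm (mat_apply M f) \<le> op_norm M * l2_norm f"
  proof (cases "l2_norm f = 0")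
    case True
    then show ?thesis using l2_norm_eq_0_iff[OF f] by simp
  next
    case False
    define c where "c = complex_of_real (1 / l2_norm f)"
    let ?g = "\<lambda>i. c * f i"
    have fing: "finite {i. ?g i \<noteq> 0}" by (rule finite_subset[OF _ fin]) auto
    have ng: "l2_norm ?g = 1" using False by (subst l2_scale(2)[OF f]) (simp add: c_def norm_divide)
    have Mg: "mat_apply M ?g = (\<lambda>j. c * mat_apply M f j)"
      unfolding mat_apply_def by (simp add: infsum_cmult_right' mult.left_commute)
    have "l2_norm (mat_apply M ?g) \<le> op_norm M"
      unfolding op_norm_def
    proof (rule cSup_upper)
      show "bdd_above {l2_norm (mat_apply M f) |f. finite {i. f i \<noteq> 0} \<and> l2_norm f \<le> 1}"
      proof (rule bdd_aboveI[of _ C])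
        fix t assume "t \<in> {l2_norm (mat_apply M f) |f. finite {i. f i \<noteq> 0} \<and> l2_norm f \<le> 1}"
        then obtain h where h: "t = l2_norm (mat_apply M h)" "finite {i. h i \<noteq> 0}" "l2_norm h \<le> 1" by blast
        have "l2 h" using h(2) by (rule l2_norm_finite_support) auto
        then have "t \<le> C * l2_norm h" using C h by (auto simp: mat_bound_def)
        also have "\<dots> \<le> C" using h mat_bound_nonneg[OF C] by (simp add: mult_left_le)
        finally show "t \<le> C" .
      qed
      show "l2_norm (mat_apply M ?g) \<in> {l2_norm (mat_apply M f) |f. finite {i. f i \<noteq> 0} \<and> l2_norm f \<le> 1}"
        using fing ng by force
    qed
    then have "l2_norm (mat_apply M f) / l2_norm f \<le> op_norm M"
      unfolding Mg l2_scale(2)[OF Mf] by (simp add: c_def norm_divide)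
    then show ?thesis using False l2_norm_nonneg[of f] by (simp add: field_simps)
  qed
  with Mf show "l2 (mat_apply M f) \<and> l2_norm (mat_apply M f) \<le> op_norm M * l2_norm f" by blast
qed

lemma l2_mat_apply: "bounded_mat M \<Longrightarrow> l2 f \<Longrightarrow> l2 (mat_apply M f)"
  using mat_bound_op_norm unfolding mat_bound_def by blast

lemma l2_norm_mat_apply: "bounded_mat M \<Longrightarrow> l2 f \<Longrightarrow> l2_norm (mat_apply M f) \<le> op_norm M * l2_norm f"
  using mat_bound_op_norm unfolding mat_bound_def by blast

lemma op_norm_nonneg: "bounded_mat M \<Longrightarrow> 0 \<le> op_norm M"
  using mat_bound_op_norm mat_bound_nonneg by blast

lemma l2_row: "bounded_mat M \<Longrightarrow> l2 (M j)"
  unfolding bounded_mat_def using row_l2_of_bound[of M] by blast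

lemma l2_column: "bounded_mat M \<Longrightarrow> l2 (\<lambda>j. M j i)"
  using l2_mat_apply[of M "unit_vec i"] by simp

lemma mat_apply_summable: "bounded_mat M \<Longrightarrow> l2 f \<Longrightarrow> (\<lambda>i. M j i * f i) summable_on UNIV"
  by (rule l2_mult_summable[OF l2_row])

lemma mat_apply_scale: "mat_apply M (\<lambda>i. c * f i) = (\<lambda>j. c * mat_apply M f j)"
  unfolding mat_apply_def by (simp add: infsum_cmult_right' mult.left_commute)

lemma mat_apply_add:
  "bounded_mat M \<Longrightarrow> l2 f \<Longrightarrow> l2 g \<Longrightarrow> mat_apply M (\<lambda>i. f i + g i) = (\<lambda>j. mat_apply M f j + mat_apply M g j)"
  unfolding mat_apply_def by (simp add: distrib_left infsum_add mat_apply_summable)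

lemma mat_apply_diff:
  "bounded_mat M \<Longrightarrow> l2 f \<Longrightarrow> l2 g \<Longrightarrow> mat_apply M (\<lambda>i. f i - g i) = (\<lambda>j. mat_apply M f j - mat_apply M g j)"
  using mat_apply_add[of M f "\<lambda>i. -1 * g i"] mat_apply_scale[of M "-1" g] l2_scale(1)[of g "-1"] by simp

lemma mat_apply_lincomb:
  assumes "bounded_mat M" "\<And>m. m \<in> A \<Longrightarrow> l2 (f m)"
  shows "mat_apply M (\<lambda>i. \<Sum>m\<in>A. c m * f m i) = (\<lambda>j. \<Sum>m\<in>A. c m * mat_apply M (f m) j)"
  using assms(2)
proof (induction A rule: infinite_finite_induct)
  case (insert a A)
  then have "mat_apply M (\<lambda>i. c a * f a i + (\<Sum>m\<in>A. c m * f m i)) =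
      (\<lambda>j. mat_apply M (\<lambda>i. c a * f a i) j + mat_apply M (\<lambda>i. \<Sum>m\<in>A. c m * f m i) j)"
    by (intro mat_apply_add assms(1) l2_scale l2_lincomb) auto
  with insert show ?case by (simp add: mat_apply_scale)
qed auto

text \<open>Duality: let \<open>f\<close> be the adjoint image of \<open>g\<close>, cut down to
  \<open>F\<close>, with norm \<open>s\<close>. Then the square of \<open>s\<close> is the modulus
  of the pairing of \<open>g\<close> with \<open>mat_apply M f\<close>, hence at most
  \<open>l2_norm g * op_norm M * s\<close>.\<close>

lemma bounded_mat_adj:
  assumes M: "bounded_mat M" shows "bounded_mat (mat_adj M)"
proof -
  have "l2 (mat_apply (mat_adj M) g) \<and> l2_norm (mat_apply (mat_adj M) g) \<le> op_norm M * l2_norm g"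
    if fin: "finite {j. g j \<noteq> 0}" for g :: "'a \<Rightarrow> complex"
  proof -
    have g: "l2 g" using fin by (rule l2_norm_finite_support) auto
    define G where "G = {j. g j \<noteq> 0}"
    have "L2_set (\<lambda>i. cmod (mat_apply (mat_adj M) g i)) F \<le> op_norm M * l2_norm g" if F: "finite F" for F
    proof -
      define f where "f = trunc F (mat_apply (mat_adj M) g)"
      define s where "s = L2_set (\<lambda>i. cmod (mat_apply (mat_adj M) g i)) F"
      have f: "l2 f" "l2_norm f = s" using F by (auto simp: f_def s_def l2_norm_trunc)
      have "complex_of_real (s\<^sup>2) = cip f f" by (simp add: cip_same f)
      also have "\<dots> = (\<Sum>i\<in>F. cnj (f i) * f i)"
        by (rule cip_finite_support[OF F]) (auto simp: f_def trunc_def)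
      also have "\<dots> = (\<Sum>i\<in>F. cnj (f i) * (\<Sum>j\<in>G. cnj (M j i) * g j))"
      proof (intro sum.cong refl)
        fix i assume "i \<in> F"
        then have "f i = mat_apply (mat_adj M) g i" by (simp add: f_def trunc_def)
        also have "\<dots> = (\<Sum>j\<in>G. cnj (M j i) * g j)"
          by (subst mat_apply_finite_support[of G]) (use fin in \<open>auto simp: G_def mat_adj_def\<close>)
        finally show "cnj (f i) * f i = cnj (f i) * (\<Sum>j\<in>G. cnj (M j i) * g j)" by simp
      qed
      also have "\<dots> = (\<Sum>j\<in>G. cnj (\<Sum>i\<in>F. M j i * f i) * g j)"
        by (simp add: sum_distrib_left sum_distrib_right sum.swap[of _ F] mult_ac)
      also have "\<dots> = (\<Sum>j\<in>G. cnj (cnj (g j) * mat_apply M f j))"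
        by (intro sum.cong refl, subst mat_apply_finite_support[of F])
          (use F in \<open>auto simp: f_def trunc_def mult_ac\<close>)
      also have "\<dots> = cnj (cip g (mat_apply M f))"
        by (subst cip_finite_support[of G]) (use fin in \<open>auto simp: G_def\<close>)
      finally have "s\<^sup>2 = cmod (cip g (mat_apply M f))"
        by (metis complex_mod_cnj norm_of_real abs_of_nonneg zero_le_power2)
      also have "\<dots> \<le> l2_norm g * l2_norm (mat_apply M f)" by (intro cip_bound g l2_mat_apply M f)
      also have "\<dots> \<le> l2_norm g * (op_norm M * s)"
        using l2_norm_mat_apply[OF M f(1)] f(2) by (intro mult_left_mono) auto
      finally have "s\<^sup>2 \<le> (op_norm M * l2_norm g) * s" by (simp add: mult_ac)
      moreover have "0 \<le> s" "0 \<le> op_norm M * l2_norm g" using op_norm_nonneg[OF M] by (auto simp: s_def)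
      ultimately show "s \<le> op_norm M * l2_norm g" by (cases "s = 0") (auto simp: power2_eq_square)
    qed
    from l2_bounded_sums[OF this] show ?thesis by blast
  qed
  then show ?thesis unfolding bounded_mat_def by blast
qed

lemma mat_apply_as_cip: "mat_apply M f j = cip (\<lambda>i. cnj (M j i)) f"
  by (simp add: mat_apply_def cip_def)

text \<open>For finitely supported \<open>g\<close> both sides are finite combinations of rows
  paired with \<open>f\<close>. Both sides depend boundedly on \<open>g\<close>, so approximation by
  truncations gives the rest.\<close>

lemma cip_mat_apply:
  assumes M: "bounded_mat M" and f: "l2 f" and g: "l2 g"
  shows "cip g (mat_apply M f) = cip (mat_apply (mat_adj M) g) f"
proof -
  note M' = bounded_mat_adj[OF M]
  have fin: "cip h (mat_apply M f) = cip (mat_apply (mat_adj M) h) f"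
    if H: "finite H" "\<And>j. j \<notin> H \<Longrightarrow> h j = 0" for h H
  proof -
    have "mat_apply (mat_adj M) h = (\<lambda>i. \<Sum>j\<in>H. h j * cnj (M j i))"
      by (simp add: fun_eq_iff mat_apply_finite_support[OF H] mat_adj_def mult.commute)
    then have "cip (mat_apply (mat_adj M) h) f = (\<Sum>j\<in>H. cnj (h j) * mat_apply M f j)"
      using l2_row[OF M] f by (simp add: cip_lincomb_left mat_apply_as_cip)
    also have "\<dots> = cip h (mat_apply M f)" by (simp add: cip_finite_support[OF H])
    finally show ?thesis by simp
  qed
  \<comment> \<open>\<open>K\<close> majorizes the factors of both error terms together; the added 1
    makes it positive, so that \<open>e / K\<close> is a legitimate tolerance.\<close>
  define K where "K = l2_norm (mat_apply M f) + op_norm (mat_adj M) * l2_norm f + 1"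
  have K: "K > 0" using op_norm_nonneg[OF M'] by (simp add: K_def add_nonneg_pos)
  have "cmod (cip g (mat_apply M f) - cip (mat_apply (mat_adj M) g) f) \<le> e" if e: "e > 0" for e
  proof -
    obtain F where F: "finite F" "l2_norm (\<lambda>i. g i - trunc F g i) < e / K"
      using obtain_trunc_close[OF g, of "e / K"] e K by auto
    let ?t = "trunc F g" let ?d = "\<lambda>i. g i - trunc F g i"
    have t0: "j \<notin> F \<Longrightarrow> ?t j = 0" for j by (simp add: trunc_def)
    have d: "l2 ?d" using F g by (intro l2_diff) auto
    have "cip g (mat_apply M f) - cip (mat_apply (mat_adj M) g) f =
        cip ?d (mat_apply M f) - cip (mat_apply (mat_adj M) ?d) f"
      using fin[OF F(1), of ?t] t0 F(1) f g
      by (simp add: cip_diff_left mat_apply_diff M' l2_mat_apply M)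
    then have "cmod (cip g (mat_apply M f) - cip (mat_apply (mat_adj M) g) f)
        \<le> cmod (cip ?d (mat_apply M f)) + cmod (cip (mat_apply (mat_adj M) ?d) f)"
      by (simp only: norm_triangle_ineq4)
    also have "\<dots> \<le> l2_norm ?d * l2_norm (mat_apply M f) + l2_norm (mat_apply (mat_adj M) ?d) * l2_norm f"
      by (rule add_mono[OF cip_bound[OF d l2_mat_apply[OF M f]] cip_bound[OF l2_mat_apply[OF M' d] f]])
    also have "\<dots> \<le> l2_norm ?d * l2_norm (mat_apply M f) + (op_norm (mat_adj M) * l2_norm ?d) * l2_norm f"
      by (rule add_left_mono[OF mult_right_mono[OF l2_norm_mat_apply[OF M' d] l2_norm_nonneg]])
    also have "\<dots> \<le> l2_norm ?d * K" by (simp add: K_def algebra_simps)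
    also have "\<dots> \<le> e" using F(2) K by (simp add: field_simps)
    finally show ?thesis .
  qed
  then have "cmod (cip g (mat_apply M f) - cip (mat_apply (mat_adj M) g) f) \<le> 0"
    by (rule field_le_epsilon[of _ 0, simplified])
  then show ?thesis by simp
qed

text \<open>Entry \<open>k\<close> pairs the conjugated row \<open>k\<close> of \<open>A\<close>
  with \<open>mat_apply B f\<close>. Moving \<open>B\<close> to the other side as its adjoint
  produces the conjugated row \<open>k\<close> of the product, so no double series has to be
  rearranged.\<close>

lemma mat_apply_mult:
  assumes "bounded_mat A" "bounded_mat B" "l2 f"
  shows "mat_apply (mat_mult A B) f = mat_apply A (mat_apply B f)"
proof
  fix k
  have "mat_apply A (mat_apply B f) k = cip (mat_apply (mat_adj B) (\<lambda>j. cnj (A k j))) f"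
    unfolding mat_apply_as_cip[of A] using assms by (intro cip_mat_apply) (auto intro: l2_row)
  also have "mat_apply (mat_adj B) (\<lambda>j. cnj (A k j)) = (\<lambda>i. cnj (mat_mult A B k i))"
    unfolding mat_apply_def mat_adj_def mat_mult_def infsum_cnj[symmetric] by (simp add: mult.commute)
  finally show "mat_apply (mat_mult A B) f k = mat_apply A (mat_apply B f) k"
    by (simp add: mat_apply_as_cip[of "mat_mult A B"])
qed

lemma bounded_mat_mult:
  assumes A: "bounded_mat A" and B: "bounded_mat B" shows "bounded_mat (mat_mult A B)"
proof -
  have "mat_bound (mat_mult A B) (op_norm A * op_norm B)"
    unfolding mat_bound_def
  proof (intro allI impI conjI)
    fix f :: "'c \<Rightarrow> complex" assume f: "l2 f"
    show "l2 (mat_apply (mat_mult A B) f)" by (simp add: mat_apply_mult A B f l2_mat_apply)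
    have "l2_norm (mat_apply A (mat_apply B f)) \<le> op_norm A * l2_norm (mat_apply B f)"
      by (intro l2_norm_mat_apply A l2_mat_apply B f)
    also have "\<dots> \<le> op_norm A * (op_norm B * l2_norm f)"
      by (intro mult_left_mono l2_norm_mat_apply B f op_norm_nonneg A)
    finally show "l2_norm (mat_apply (mat_mult A B) f) \<le> op_norm A * op_norm B * l2_norm f"
      by (simp add: mat_apply_mult A B f mult.assoc)
  qed
  then show ?thesis by (rule mat_bound_imp_bounded_mat)
qed

lemma mat_mult_entry: "mat_mult A B k i = mat_apply A (\<lambda>j. B j i) k"
  by (simp add: mat_mult_def mat_apply_def)

lemma mat_eqI: "(\<And>i. mat_apply A (unit_vec i) = mat_apply B (unit_vec i)) \<Longrightarrow> A = B"
  by (auto simp: fun_eq_iff)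

section \<open>Rank\<close>

text \<open>Gaussian elimination by induction on the equations \<open>L\<close>, with unknowns
  indexed by \<open>M\<close>: an equation with a nonzero coefficient is used to remove one
  unknown.\<close>

lemma homogeneous_system_solution:
  fixes A :: "'m \<Rightarrow> 'l \<Rightarrow> complex"
  assumes "finite L" "finite M" "card L < card M"
  shows "\<exists>c. (\<exists>m\<in>M. c m \<noteq> 0) \<and> (\<forall>l\<in>L. (\<Sum>m\<in>M. c m * A m l) = 0)"
  using assms
proof (induction L arbitrary: M A rule: finite_induct)
  case empty
  then obtain m where "m \<in> M" by fastforce
  then show ?case by (intro exI[of _ "\<lambda>_. 1"]) auto
next
  case (insert l L)
  show ?case
  proof (cases "\<forall>m\<in>M. A m l = 0")
    case True
    obtain c where "\<exists>m\<in>M. c m \<noteq> 0" "\<forall>l\<in>L. (\<Sum>m\<in>M. c m * A m l) = 0"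
      using insert.IH[of M A] insert.prems insert.hyps by auto
    then show ?thesis using True by (intro exI[of _ c]) auto
  next
    case False
    then obtain p where p: "p \<in> M" "A p l \<noteq> 0" by blast
    let ?N = "M - {p}"
    \<comment> \<open>The coefficients left after equation \<open>l\<close> is solved for the
      unknown \<open>p\<close> and substituted into the others.\<close>
    define B where "B = (\<lambda>m l'. A m l' - A m l / A p l * A p l')"
    have "card L < card ?N" using insert p by simp
    then obtain c where c: "\<exists>m\<in>?N. c m \<noteq> 0" "\<forall>l'\<in>L. (\<Sum>m\<in>?N. c m * B m l') = 0"
      using insert.IH[of ?N B] insert.prems by auto
    \<comment> \<open>Equation \<open>l\<close> forces the value \<open>- s\<close> on the unknown
      \<open>p\<close>.\<close>
    define s where "s = (\<Sum>m\<in>?N. c m * (A m l / A p l))"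
    define d where "d = c(p := - s)"
    have split: "(\<Sum>m\<in>M. d m * A m l') = - s * A p l' + (\<Sum>m\<in>?N. c m * A m l')" for l'
      using p insert.prems by (subst sum.remove[of M p]) (auto simp: d_def intro!: sum.cong)
    have "(\<Sum>m\<in>M. d m * A m l') = (\<Sum>m\<in>?N. c m * B m l')" for l'
      unfolding split s_def B_def
      by (simp add: sum_distrib_left sum_distrib_right sum_subtractf algebra_simps)
    moreover have "(\<Sum>m\<in>?N. c m * B m l) = 0" using p by (simp add: B_def)
    ultimately have "\<forall>l'\<in>insert l L. (\<Sum>m\<in>M. d m * A m l') = 0" using c by auto
    moreover have "\<exists>m\<in>M. d m \<noteq> 0" using c by (auto simp: d_def)
    ultimately show ?thesis by blast
  qed
qed

text \<open>\<open>A\<close> gives \<open>card L\<close> homogeneous equations in \<open>k\<close>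
  unknowns. With more unknowns than equations, a nontrivial solution would be a linear relation
  among the \<open>v m\<close>.\<close>

lemma lin_indep_le_card_span:
  assumes indep: "lin_indep_vecs v k" and L: "finite L"
    and span: "\<And>m j. m < k \<Longrightarrow> v m j = (\<Sum>l\<in>L. A m l * s l j)"
  shows "k \<le> card L"
proof (rule ccontr)
  assume "\<not> k \<le> card L"
  then obtain c where c: "\<exists>m\<in>{..<k}. c m \<noteq> 0" "\<forall>l\<in>L. (\<Sum>m<k. c m * A m l) = 0"
    using homogeneous_system_solution[of L "{..<k}" A] L by auto
  have "(\<Sum>m<k. c m * v m j) = 0" for j
  proof -
    have "(\<Sum>m<k. c m * v m j) = (\<Sum>m<k. \<Sum>l\<in>L. c m * A m l * s l j)"
      by (simp add: span sum_distrib_left mult.assoc)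
    also have "\<dots> = (\<Sum>l\<in>L. (\<Sum>m<k. c m * A m l) * s l j)"
      by (subst sum.swap) (simp add: sum_distrib_right)
    also have "\<dots> = 0" using c by simp
    finally show ?thesis .
  qed
  then show False using indep c unfolding lin_indep_vecs_def by blast
qed

lemma rank_at_least_mono:
  assumes "rank_at_least M k" "k' \<le> k" shows "rank_at_least M k'"
proof -
  obtain v where v: "\<forall>m<k. l2 (v m)" "lin_indep_vecs (\<lambda>m. mat_apply M (v m)) k"
    using assms unfolding rank_at_least_def by blast
  have "lin_indep_vecs (\<lambda>m. mat_apply M (v m)) k'"
    unfolding lin_indep_vecs_def
  proof (intro allI impI)
    fix c :: "nat \<Rightarrow> complex" and m
    assume c: "\<forall>j. (\<Sum>m<k'. c m * mat_apply M (v m) j) = 0" and m: "m < k'"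
    define d where "d = (\<lambda>m. if m < k' then c m else 0)"
    have "(\<Sum>m<k. d m * mat_apply M (v m) j) = (\<Sum>m<k'. c m * mat_apply M (v m) j)" for j
      using assms(2) by (intro sum.mono_neutral_cong_right) (auto simp: d_def)
    then have "d m = 0" using v c m assms(2) unfolding lin_indep_vecs_def by auto
    then show "c m = 0" using m by (simp add: d_def)
  qed
  then show ?thesis using v assms(2) unfolding rank_at_least_def by (intro exI[of _ v]) auto
qed

text \<open>Rank at least 1 supplies \<open>v\<close> with nonzero image. Since rank 2 fails, the
  images of \<open>v\<close> and \<open>f\<close> satisfy a relation, and the coefficient of the
  image of \<open>f\<close> is nonzero because the image of \<open>v\<close> is.\<close>

lemma has_rank_1D:
  assumes "has_rank M 1"
  obtains v where "l2 v" "mat_apply M v \<noteq> (\<lambda>j. 0)"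
    "\<And>f. l2 f \<Longrightarrow> \<exists>c. mat_apply M f = (\<lambda>j. c * mat_apply M v j)"
proof -
  have r1: "rank_at_least M 1" and r2: "\<not> rank_at_least M 2"
    using assms[unfolded has_rank_def, rule_format, of 1] assms[unfolded has_rank_def, rule_format, of 2]
    unfolding one_enat_def enat_ord_simps by simp_all
  obtain v where v: "l2 (v 0)" "lin_indep_vecs (\<lambda>m. mat_apply M (v m)) 1"
    using r1 unfolding rank_at_least_def by auto
  have nz: "mat_apply M (v 0) \<noteq> (\<lambda>j. 0)"
    using v(2)[unfolded lin_indep_vecs_def, rule_format, of "\<lambda>_. 1" 0] by auto
  have "\<exists>c. mat_apply M f = (\<lambda>j. c * mat_apply M (v 0) j)" if f: "l2 f" for f
  proof -
    define u where "u = (\<lambda>m::nat. if m = 0 then v 0 else f)"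
    have "\<forall>m<2. l2 (u m)" using v f by (auto simp: u_def)
    then have "\<not> lin_indep_vecs (\<lambda>m. mat_apply M (u m)) 2" using r2 unfolding rank_at_least_def by blast
    then obtain c m where c: "\<forall>j. (\<Sum>m<2. c m * mat_apply M (u m) j) = 0" "m < 2" "c m \<noteq> 0"
      unfolding lin_indep_vecs_def by blast
    have eq: "c 0 * mat_apply M (v 0) j + c 1 * mat_apply M f j = 0" for j
      using c(1)[rule_format, of j] by (simp add: u_def numeral_2_eq_2)
    have "c 1 \<noteq> 0"
    proof
      assume c1: "c 1 = 0"
      then have "c 0 \<noteq> 0" using c(2,3) by (cases "m = 0") (auto simp: less_2_cases_iff)
      then have "mat_apply M (v 0) = (\<lambda>j. 0)" using eq c1 by auto
      with nz show False ..
    qed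
    then have "mat_apply M f j = (- c 0 / c 1) * mat_apply M (v 0) j" for j
      using eq[of j] by (simp add: field_simps eq_neg_iff_add_eq_0)
    then show ?thesis by blast
  qed
  with that v nz show ?thesis by blast
qed

section \<open>Amplification\<close>

lemma mat_apply_amplify:
  "mat_apply (amplify a) h (x, k) = mat_apply a (\<lambda>y. h (y, k)) x"
proof -
  have "mat_apply (amplify a) h (x, k) = infsum (\<lambda>p. amplify a (x, k) p * h p) (range (\<lambda>y. (y, k)))"
    unfolding mat_apply_def
    by (rule infsum_cong_neutral) (auto simp: amplify_def image_iff)
  also have "\<dots> = mat_apply a (\<lambda>y. h (y, k)) x"
    by (subst infsum_reindex) (auto simp: inj_on_def o_def amplify_def mat_apply_def)
  finally show ?thesis .
qed

lemma L2_set_Times: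
  assumes "finite A" "finite B"
  shows "(L2_set (\<lambda>p. cmod (h p)) (A \<times> B))\<^sup>2 = (\<Sum>k\<in>B. (L2_set (\<lambda>x. cmod (h (x, k))) A)\<^sup>2)"
proof -
  have "(L2_set (\<lambda>p. cmod (h p)) (A \<times> B))\<^sup>2 = (\<Sum>x\<in>A. \<Sum>k\<in>B. (cmod (h (x, k)))\<^sup>2)"
    by (simp add: L2_set_def sum_nonneg sum.cartesian_product case_prod_unfold)
  also have "\<dots> = (\<Sum>k\<in>B. \<Sum>x\<in>A. (cmod (h (x, k)))\<^sup>2)" by (rule sum.swap)
  finally show ?thesis by (simp add: L2_set_def sum_nonneg)
qed

text \<open>The squared norm splits over the slices with fixed second coordinate, and
  \<open>amplify a\<close> acts on each slice as \<open>a\<close>, with the same constant.\<close>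

lemma amplify_bound:
  fixes a :: "'x \<Rightarrow> 'x \<Rightarrow> complex"
  assumes a: "bounded_mat a"
  shows "mat_bound (amplify a :: 'x \<times> 'k \<Rightarrow> 'x \<times> 'k \<Rightarrow> complex) (op_norm a)"
proof (rule mat_boundI_finite)
  fix h :: "'x \<times> 'k \<Rightarrow> complex" assume fin: "finite {p. h p \<noteq> 0}"
  define A where "A = fst ` {p. h p \<noteq> 0}"
  define B where "B = snd ` {p. h p \<noteq> 0}"
  have AB: "finite A" "finite B" using fin by (auto simp: A_def B_def)
  have h0: "h (x, k) = 0" if "x \<notin> A \<or> k \<notin> B" for x k
    using that by (force simp: A_def B_def)
  have nh: "l2_norm h = L2_set (\<lambda>p. cmod (h p)) (A \<times> B)"
    using AB h0 by (intro l2_norm_finite_support) auto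
  have hk: "l2 (\<lambda>y. h (y, k))" "l2_norm (\<lambda>y. h (y, k)) = L2_set (\<lambda>y. cmod (h (y, k))) A" for k
    using l2_norm_finite_support[OF AB(1), of "\<lambda>y. h (y, k)"] h0 by auto
  have "L2_set (\<lambda>p. cmod (mat_apply (amplify a) h p)) F \<le> op_norm a * l2_norm h" if F: "finite F" for F
  proof -
    \<comment> \<open>Enlarging \<open>F\<close> to a rectangle makes the sum split by slices.
      Including \<open>B\<close> in the second side ensures that the slices of \<open>h\<close> add
      up to its full norm.\<close>
    define A' where "A' = fst ` F"
    define B' where "B' = snd ` F \<union> B"
    have fin': "finite A'" "finite B'" using F AB by (auto simp: A'_def B'_def)
    have "L2_set (\<lambda>p. cmod (mat_apply (amplify a) h p)) F \<le> L2_set (\<lambda>p. cmod (mat_apply (amplify a) h p)) (A' \<times> B')"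
      unfolding L2_set_def using fin'
      by (intro real_sqrt_le_mono sum_mono2) (force simp: A'_def B'_def)+
    moreover have "(L2_set (\<lambda>p. cmod (mat_apply (amplify a) h p)) (A' \<times> B'))\<^sup>2 \<le> (op_norm a * l2_norm h)\<^sup>2"
    proof -
      have "(L2_set (\<lambda>p. cmod (mat_apply (amplify a) h p)) (A' \<times> B'))\<^sup>2
          = (\<Sum>k\<in>B'. (L2_set (\<lambda>x. cmod (mat_apply a (\<lambda>y. h (y, k)) x)) A')\<^sup>2)"
        by (simp add: L2_set_Times fin' mat_apply_amplify)
      also have "\<dots> \<le> (\<Sum>k\<in>B'. (op_norm a * l2_norm (\<lambda>y. h (y, k)))\<^sup>2)"
        by (intro sum_mono power_mono order_trans[OF L2_set_le_l2_norm l2_norm_mat_apply] l2_mat_apply a hk fin') auto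
      also have "\<dots> = (op_norm a)\<^sup>2 * (\<Sum>k\<in>B'. (L2_set (\<lambda>y. cmod (h (y, k))) A)\<^sup>2)"
        by (simp add: power_mult_distrib sum_distrib_left hk(2))
      also have "(\<Sum>k\<in>B'. (L2_set (\<lambda>y. cmod (h (y, k))) A)\<^sup>2) = (\<Sum>k\<in>B. (L2_set (\<lambda>y. cmod (h (y, k))) A)\<^sup>2)"
        using fin' h0 by (intro sum.mono_neutral_right) (auto simp: B'_def L2_set_def)
      also have "\<dots> = (l2_norm h)\<^sup>2" by (simp add: nh L2_set_Times AB)
      finally show ?thesis by (simp add: power_mult_distrib)
    qed
    ultimately show ?thesis
      using op_norm_nonneg[OF a] by (meson l2_norm_nonneg mult_nonneg_nonneg order_trans power2_le_imp_le)
  qed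
  from l2_bounded_sums[OF this]
  show "l2 (mat_apply (amplify a) h) \<and> l2_norm (mat_apply (amplify a) h) \<le> op_norm a * l2_norm h" by blast
qed

lemma bounded_mat_amplify: "bounded_mat a \<Longrightarrow> bounded_mat (amplify a)"
  by (rule mat_bound_imp_bounded_mat[OF amplify_bound])

text \<open>The vector is the elementary tensor of \<open>f\<close> with the basis vector at
  \<open>l\<close>.\<close>

lemma l2_slice:
  assumes "l2 f"
  shows "l2 (\<lambda>(x, k). if k = l then f x else 0)"
    and "l2_norm (\<lambda>(x, k). if k = l then f x else 0) \<le> l2_norm f"
proof -
  have "L2_set (\<lambda>p. cmod (case p of (x, k) \<Rightarrow> if k = l then f x else 0)) F \<le> l2_norm f" if F: "finite F" for F
  proof -
    define A where "A = fst ` F"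
    define B where "B = insert l (snd ` F)"
    have AB: "finite A" "finite B" using F by (auto simp: A_def B_def)
    have "(L2_set (\<lambda>p. cmod (case p of (x, k) \<Rightarrow> if k = l then f x else 0)) F)\<^sup>2
        \<le> (L2_set (\<lambda>p. cmod (case p of (x, k) \<Rightarrow> if k = l then f x else 0)) (A \<times> B))\<^sup>2"
      unfolding L2_set_def using AB
      by (intro power_mono real_sqrt_le_mono sum_mono2) (force simp: A_def B_def sum_nonneg)+
    also have "\<dots> = (\<Sum>k\<in>B. if k = l then (L2_set (\<lambda>x. cmod (f x)) A)\<^sup>2 else 0)"
      by (subst L2_set_Times[OF AB]) (auto intro!: sum.cong simp: L2_set_def)
    also have "\<dots> = (L2_set (\<lambda>x. cmod (f x)) A)\<^sup>2" using AB by (simp add: B_def)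
    finally show ?thesis
      using L2_set_le_l2_norm[OF assms AB(1)] by (meson L2_set_nonneg order_trans power2_le_imp_le)
  qed
  from l2_bounded_sums[OF this]
  show "l2 (\<lambda>(x, k). if k = l then f x else 0)" "l2_norm (\<lambda>(x, k). if k = l then f x else 0) \<le> l2_norm f"
    by blast+
qed

lemma amplify_slice:
  "mat_apply (amplify a) (\<lambda>(x, k). if k = l then f x else 0) = (\<lambda>(x, k). if k = l then mat_apply a f x else 0)"
  by (auto simp: fun_eq_iff mat_apply_amplify)

section \<open>Isometries\<close>

lemma l2_norm_add_power2:
  assumes "l2 f" "l2 g"
  shows "(l2_norm (\<lambda>i. f i + g i))\<^sup>2 = (l2_norm f)\<^sup>2 + (l2_norm g)\<^sup>2 + 2 * Re (cip f g)"
proof -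
  have "of_real ((l2_norm (\<lambda>i. f i + g i))\<^sup>2) = cip (\<lambda>i. f i + g i) (\<lambda>i. f i + g i)"
    by (simp only: cip_same l2_add assms)
  also have "\<dots> = cip f f + cip g g + (cip f g + cnj (cip f g))"
    using assms by (simp add: cip_add_left cip_add_right l2_add cip_commute[of g f])
  also have "\<dots> = of_real ((l2_norm f)\<^sup>2 + (l2_norm g)\<^sup>2 + 2 * Re (cip f g))"
    by (simp only: cip_same assms complex_add_cnj of_real_add)
  finally show ?thesis by (simp only: of_real_eq_iff)
qed

text \<open>Polarization: norms of sums determine real parts of inner products, and replacing
  \<open>g\<close> by its multiple with \<open>- \<i>\<close> turns the imaginary part into a real
  part.\<close>

lemma isometry_cip:
  assumes U: "isometry_mat U" and f: "l2 f" and g: "l2 g"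
  shows "cip (mat_apply U f) (mat_apply U g) = cip f g"
proof -
  have bU: "bounded_mat U" and nU: "\<And>f. l2 f \<Longrightarrow> l2_norm (mat_apply U f) = l2_norm f"
    using U unfolding isometry_mat_def by auto
  have re: "Re (cip (mat_apply U f) (mat_apply U h)) = Re (cip f h)" if h: "l2 h" for h
    using l2_norm_add_power2[OF f h] l2_norm_add_power2[OF l2_mat_apply[OF bU f] l2_mat_apply[OF bU h]]
      nU[OF l2_add(1)[OF f h]] nU f h by (simp add: mat_apply_add[OF bU f h])
  have "Re (- \<i> * cip (mat_apply U f) (mat_apply U g)) = Re (- \<i> * cip f g)"
    using re[OF l2_scale(1)[OF g, of "- \<i>"]] by (simp only: mat_apply_scale cip_scale_right)
  with re[OF g] show ?thesis by (simp add: complex_eq_iff)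
qed

lemma isometry_adj:
  assumes U: "isometry_mat U" and f: "l2 f"
  shows "mat_apply (mat_adj U) (mat_apply U f) = f"
proof
  fix i
  have "mat_apply (mat_adj U) (mat_apply U f) i = cip (mat_apply U (unit_vec i)) (mat_apply U f)"
    by (simp add: mat_apply_as_cip mat_adj_def)
  also have "\<dots> = f i" by (simp only: isometry_cip[OF U l2_unit_vec f] cip_unit_vec)
  finally show "mat_apply (mat_adj U) (mat_apply U f) i = f i" .
qed

text \<open>On finitely supported vectors the norm is computed directly from orthonormality, which
  yields boundedness. The adjoint relation then becomes available, and the adjoint of
  \<open>U\<close> times \<open>U\<close> being the identity gives the norm on all of l2.\<close>

lemma isometry_orthonormal_columns:
  fixes U :: "'j \<Rightarrow> 'i \<Rightarrow> complex"
  assumes l2: "\<And>i. l2 (\<lambda>j. U j i)"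
    and on: "\<And>i i'. cip (\<lambda>j. U j i) (\<lambda>j. U j i') = (if i = i' then 1 else 0)"
  shows "isometry_mat U"
proof -
  have bU: "bounded_mat U"
    unfolding bounded_mat_def
  proof (intro exI[of _ 1] allI impI)
    fix f :: "'i \<Rightarrow> complex" assume fin: "finite {i. f i \<noteq> 0}"
    define F where "F = {i. f i \<noteq> 0}"
    have F: "finite F" "\<And>i. i \<notin> F \<Longrightarrow> f i = 0" using fin by (auto simp: F_def)
    have f: "l2 f" by (rule l2_norm_finite_support(1)[OF F])
    have Uf: "mat_apply U f = (\<lambda>j. \<Sum>i\<in>F. f i * U j i)"
      by (simp add: fun_eq_iff mat_apply_finite_support[OF F] mult.commute)
    then have lU: "l2 (mat_apply U f)" using l2 by (simp add: l2_lincomb)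
    have "of_real ((l2_norm (mat_apply U f))\<^sup>2) = cip (mat_apply U f) (mat_apply U f)"
      by (simp only: cip_same lU)
    also have "\<dots> = (\<Sum>i\<in>F. f i * cip (mat_apply U f) (\<lambda>j. U j i))"
      using lU l2 by (subst (2) Uf) (rule cip_lincomb_right)
    also have "\<dots> = (\<Sum>i\<in>F. f i * cnj (f i))"
      unfolding Uf using F(1) by (simp add: cip_lincomb_left l2 on if_distrib[where f="\<lambda>x. _ * x"] cong: if_cong)
    also have "\<dots> = cip f f" by (simp add: cip_finite_support[OF F] mult.commute)
    also have "\<dots> = of_real ((l2_norm f)\<^sup>2)" by (rule cip_same[OF f])
    finally have "l2_norm (mat_apply U f) = l2_norm f"
      by (simp only: of_real_eq_iff) (simp add: power2_eq_iff_nonneg)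
    with lU show "l2 (mat_apply U f) \<and> l2_norm (mat_apply U f) \<le> 1 * l2_norm f" by simp
  qed
  have "l2_norm (mat_apply U f) = l2_norm f" if f: "l2 f" for f
  proof -
    have "mat_mult (mat_adj U) U = (\<lambda>i. unit_vec i)"
      using on by (auto simp: fun_eq_iff mat_mult_def mat_adj_def cip_def unit_vec_def)
    moreover have "(\<lambda>j. cnj (unit_vec i j)) = unit_vec i" for i :: 'i by (auto simp: unit_vec_def)
    ultimately have UU: "mat_apply (mat_adj U) (mat_apply U f) = f"
      by (auto simp: mat_apply_mult[OF bounded_mat_adj[OF bU] bU f, symmetric] mat_apply_as_cip)
    have "of_real ((l2_norm (mat_apply U f))\<^sup>2) = cip (mat_apply U f) (mat_apply U f)"
      by (simp only: cip_same l2_mat_apply bU f)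
    also have "\<dots> = cip f f" using cip_mat_apply[OF bU f l2_mat_apply[OF bU f]] UU by simp
    also have "\<dots> = of_real ((l2_norm f)\<^sup>2)" by (rule cip_same[OF f])
    finally show ?thesis by (simp only: of_real_eq_iff) (simp add: power2_eq_iff_nonneg)
  qed
  then show ?thesis unfolding isometry_mat_def using bU l2_mat_apply by blast
qed

section \<open>Amplified conjugation\<close>

definition conj_amplify :: "('y \<Rightarrow> 'x \<times> 'k \<Rightarrow> complex) \<Rightarrow> ('x \<Rightarrow> 'x \<Rightarrow> complex) \<Rightarrow> 'y \<Rightarrow> 'y \<Rightarrow> complex" where
  "conj_amplify U a = mat_mult (mat_mult U (amplify a)) (mat_adj U)"

lemma isometry_bounded: "isometry_mat U \<Longrightarrow> bounded_mat U"
  by (simp add: isometry_mat_def)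

lemma isometry_norm: "isometry_mat U \<Longrightarrow> l2 f \<Longrightarrow> l2_norm (mat_apply U f) = l2_norm f"
  by (simp add: isometry_mat_def)

lemma mat_apply_conj_amplify:
  assumes "bounded_mat U" "bounded_mat a" "l2 f"
  shows "mat_apply (conj_amplify U a) f = mat_apply U (mat_apply (amplify a) (mat_apply (mat_adj U) f))"
  unfolding conj_amplify_def using assms
  by (simp add: mat_apply_mult bounded_mat_mult bounded_mat_adj bounded_mat_amplify l2_mat_apply)

lemma bounded_conj_amplify: "bounded_mat U \<Longrightarrow> bounded_mat a \<Longrightarrow> bounded_mat (conj_amplify U a)"
  unfolding conj_amplify_def by (intro bounded_mat_mult bounded_mat_adj bounded_mat_amplify)

lemma uniform_roe_bounded: "uniform_roe a \<Longrightarrow> bounded_mat a"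
  by (simp add: uniform_roe_def)

text \<open>With \<open>\<xi>\<close> spanning the range of \<open>a\<close>, the range of the
  conjugate is spanned by the vectors \<open>mat_apply U (sl \<xi> l)\<close> when \<open>'k\<close>
  is finite. They are attained at \<open>mat_apply U (sl v l)\<close>, and they are independent for
  distinct \<open>l\<close> because \<open>U\<close> is injective and \<open>\<xi>\<close> is
  nonzero.\<close>

lemma conj_amplify_has_rank:
  fixes U :: "'y \<Rightarrow> 'x \<times> 'k \<Rightarrow> complex"
  assumes U: "isometry_mat U" and a: "bounded_mat a" and rank: "has_rank a 1"
  shows "has_rank (conj_amplify U a) (if finite (UNIV :: 'k set) then enat CARD('k) else \<infinity>)"
proof -
  note bU = isometry_bounded[OF U]
  obtain v where v: "l2 v" "mat_apply a v \<noteq> (\<lambda>j. 0)"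
    and rk: "\<And>f. l2 f \<Longrightarrow> \<exists>c. mat_apply a f = (\<lambda>j. c * mat_apply a v j)"
    using has_rank_1D[OF rank] by metis
  define \<xi> where "\<xi> = mat_apply a v"
  obtain x where x: "\<xi> x \<noteq> 0" using v(2) by (auto simp: \<xi>_def)
  have \<xi>: "l2 \<xi>" unfolding \<xi>_def by (intro l2_mat_apply a v)
  define sl where "sl = (\<lambda>f (l::'k) (x::'x, k). if k = l then f x else (0::complex))"
  have l2sl: "l2 (sl f l)" if "l2 f" for f l using l2_slice(1)[OF that] by (simp add: sl_def)
  have lower: "rank_at_least (conj_amplify U a) k" if K: "finite K" "card K = k" for K :: "'k set" and k
  proof -
    obtain e where e: "bij_betw e {..<k} K"
      using ex_bij_betw_nat_finite[OF K(1)] K(2) by (auto simp: atLeast0LessThan)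
    define u where "u = (\<lambda>m. mat_apply U (sl v (e m)))"
    have u: "l2 (u m)" for m unfolding u_def by (intro l2_mat_apply bU l2sl v)
    have im: "mat_apply (conj_amplify U a) (u m) = mat_apply U (sl \<xi> (e m))" for m
      unfolding mat_apply_conj_amplify[OF bU a u] unfolding u_def
      by (subst isometry_adj[OF U l2sl[OF v(1)]]) (simp add: sl_def \<xi>_def amplify_slice)
    have "lin_indep_vecs (\<lambda>m. mat_apply (conj_amplify U a) (u m)) k"
      unfolding lin_indep_vecs_def im
    proof (intro allI impI)
      fix c :: "nat \<Rightarrow> complex" and m
      assume c: "\<forall>j. (\<Sum>m<k. c m * mat_apply U (sl \<xi> (e m)) j) = 0" and m: "m < k"
      define g where "g = (\<lambda>p. \<Sum>m<k. c m * sl \<xi> (e m) p)"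
      have g: "l2 g" unfolding g_def by (intro l2_lincomb l2sl \<xi>)
      have "mat_apply U g = (\<lambda>j. 0)"
        unfolding g_def using c by (subst mat_apply_lincomb[OF bU]) (auto intro: l2sl \<xi>)
      then have "g = (\<lambda>p. 0)" using isometry_adj[OF U g] by simp
      \<comment> \<open>Distinct slices do not overlap, so evaluation at a point over
        \<open>x\<close> in slice \<open>e m\<close> isolates the coefficient
        \<open>c m\<close>.\<close>
      then have "0 = g (x, e m)" by simp
      also have "\<dots> = (\<Sum>m'<k. if m' = m then c m * \<xi> x else 0)"
        unfolding g_def sl_def using e m
        by (intro sum.cong) (auto simp: bij_betw_def inj_on_def)
      also have "\<dots> = c m * \<xi> x" using m by simp
      finally show "c m = 0" using x by simp
    qed
    then show ?thesis unfolding rank_at_least_def using u by blast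
  qed
  show ?thesis
  proof (cases "finite (UNIV :: 'k set)")
    case True
    have upper: "k \<le> CARD('k)" if rk': "rank_at_least (conj_amplify U a) k" for k
    proof -
      obtain f where f: "\<forall>m<k. l2 (f m)" and ind: "lin_indep_vecs (\<lambda>m. mat_apply (conj_amplify U a) (f m)) k"
        using rk' unfolding rank_at_least_def by blast
      define g where "g = (\<lambda>m. mat_apply (mat_adj U) (f m))"
      have g: "l2 (g m)" if "m < k" for m
        using f that unfolding g_def by (auto intro: l2_mat_apply bounded_mat_adj bU)
      \<comment> \<open>The bound on \<open>m\<close> sits inside the existential so that a single
        choice function on all pairs results.\<close>
      have "\<forall>m l. \<exists>c. m < k \<longrightarrow> mat_apply a (\<lambda>y. g m (y, l)) = (\<lambda>j. c * \<xi> j)"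
      proof (intro allI)
        fix m l
        show "\<exists>c. m < k \<longrightarrow> mat_apply a (\<lambda>y. g m (y, l)) = (\<lambda>j. c * \<xi> j)"
        proof (cases "m < k")
          case True
          have "l2 (\<lambda>y. g m (y, l))"
          proof (rule l2_bounded_sums(1))
            fix F :: "'x set" assume F: "finite F"
            have "L2_set (\<lambda>y. cmod (g m (y, l))) F = L2_set (\<lambda>p. cmod (g m p)) ((\<lambda>y. (y, l)) ` F)"
              unfolding L2_set_def by (subst sum.reindex) (auto simp: inj_on_def)
            also have "\<dots> \<le> l2_norm (g m)" by (intro L2_set_le_l2_norm g True finite_imageI F)
            finally show "L2_set (\<lambda>y. cmod (g m (y, l))) F \<le> l2_norm (g m)" .
          qed
          from rk[OF this] show ?thesis by (auto simp: \<xi>_def)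
        qed auto
      qed
      then obtain c where c: "\<And>m l. m < k \<Longrightarrow> mat_apply a (\<lambda>y. g m (y, l)) = (\<lambda>j. c m l * \<xi> j)" by metis
      have "mat_apply (conj_amplify U a) (f m) j = (\<Sum>l\<in>UNIV. c m l * mat_apply U (sl \<xi> l) j)" if m: "m < k" for m j
      proof -
        have "mat_apply (amplify a) (g m) (x, l) = (\<Sum>l'\<in>UNIV. c m l' * sl \<xi> l' (x, l))" for x l
        proof -
          have "(\<Sum>l'\<in>UNIV. c m l' * sl \<xi> l' (x, l)) = (\<Sum>l'\<in>UNIV. if l' = l then c m l * \<xi> x else 0)"
            by (intro sum.cong) (auto simp: sl_def)
          then show ?thesis using True by (simp add: mat_apply_amplify c m)
        qed
        then have "mat_apply (amplify a) (g m) = (\<lambda>p. \<Sum>l\<in>UNIV. c m l * sl \<xi> l p)" by auto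
        then show ?thesis
          using f m by (simp add: mat_apply_conj_amplify[OF bU a] g_def mat_apply_lincomb[OF bU] l2sl \<xi>)
      qed
      then show ?thesis by (rule lin_indep_le_card_span[OF ind True])
    qed
    show ?thesis using True upper lower[OF True refl] rank_at_least_mono
      by (auto simp: has_rank_def)
  next
    case False
    have "rank_at_least (conj_amplify U a) k" for k
      using infinite_arbitrarily_large[OF False, of k] lower by auto
    then show ?thesis using False by (simp add: has_rank_def)
  qed
qed

lemma conj_amplify_strongly_continuous:
  fixes U :: "'y \<Rightarrow> 'x::metric_space \<times> 'k \<Rightarrow> complex"
  assumes U: "isometry_mat U"
  shows "strongly_continuous (conj_amplify U)"
  unfolding strongly_continuous_def
proof (intro allI impI)
  fix C \<epsilon> :: real and a :: "'x \<Rightarrow> 'x \<Rightarrow> complex" and f :: "'y \<Rightarrow> complex"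
  assume asm: "uniform_roe a \<and> op_norm a \<le> C \<and> l2 f \<and> 0 < \<epsilon>"
  then have a: "bounded_mat a" and aC: "op_norm a \<le> C" and f: "l2 f" and \<epsilon>: "\<epsilon> > 0"
    by (auto simp: uniform_roe_def)
  note bU = isometry_bounded[OF U]
  have C: "0 \<le> C" using op_norm_nonneg[OF a] aC by linarith
  define h where "h = mat_apply (mat_adj U) f"
  have h: "l2 h" unfolding h_def by (intro l2_mat_apply bounded_mat_adj bU f)
  \<comment> \<open>The tail enters through both \<open>a\<close> and \<open>b\<close>, at a cost of
    at most \<open>2 * C * l2_norm r\<close>; the denominator \<open>4 * C + 1\<close> keeps this
    below half of \<open>\<epsilon>\<close> and remains positive for \<open>C = 0\<close>.\<close>
  obtain F where F: "finite F" "l2_norm (\<lambda>i. h i - trunc F h i) < \<epsilon> / (4 * C + 1)"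
    using obtain_trunc_close[OF h, of "\<epsilon> / (4 * C + 1)"] \<epsilon> C by auto
  define r where "r = (\<lambda>i. h i - trunc F h i)"
  have r: "l2 r" unfolding r_def using h F by (intro l2_diff) auto
  define S where "S = (\<Sum>p\<in>F. cmod (h p))"
  have S: "0 \<le> S" by (simp add: S_def sum_nonneg)
  \<comment> \<open>Chosen so that \<open>S * \<delta>\<close> is at most half of
    \<open>\<epsilon>\<close>; the 1 covers the case \<open>S = 0\<close>.\<close>
  define \<delta> where "\<delta> = \<epsilon> / (2 * S + 1)"
  \<comment> \<open>First coordinates suffice: in each slice, the amplified difference at
    \<open>(x, l)\<close> is the column of \<open>b - a\<close> at \<open>x\<close>.\<close>
  define G where "G = (\<lambda>p. unit_vec (fst p)) ` F"
  have "l2_norm (\<lambda>y. mat_apply (conj_amplify U b) f y - mat_apply (conj_amplify U a) f y) < \<epsilon>"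
    if b': "uniform_roe b \<and> op_norm b \<le> C \<and> (\<forall>g\<in>G. l2_norm (\<lambda>x. mat_apply b g x - mat_apply a g x) < \<delta>)" for b
  proof -
    have b: "bounded_mat b" and bC: "op_norm b \<le> C" using b' by (auto simp: uniform_roe_def)
    let ?A = "amplify a :: 'x \<times> 'k \<Rightarrow> _" and ?B = "amplify b :: 'x \<times> 'k \<Rightarrow> _"
    have bd: "l2 (mat_apply (amplify c) g)" "l2_norm (mat_apply (amplify c) g) \<le> C * l2_norm g"
      if "bounded_mat c" "op_norm c \<le> C" "l2 g" for c and g :: "'x \<times> 'k \<Rightarrow> complex"
    proof -
      have "l2_norm (mat_apply (amplify c) g) \<le> op_norm c * l2_norm g"
        using amplify_bound[OF that(1)] that(3) unfolding mat_bound_def by blast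
      also have "\<dots> \<le> C * l2_norm g" using that by (intro mult_right_mono) auto
      finally show "l2_norm (mat_apply (amplify c) g) \<le> C * l2_norm g" .
      show "l2 (mat_apply (amplify c) g)" using that by (intro l2_mat_apply bounded_mat_amplify)
    qed
    let ?D = "\<lambda>g p. mat_apply ?B g p - mat_apply ?A g p"
    have D: "l2 (?D g)" if "l2 g" for g using that a b aC bC by (intro l2_diff bd)
    have Dr: "l2_norm (?D r) \<le> C * l2_norm r + C * l2_norm r"
      using l2_diff(2)[OF bd(1)[OF b bC r] bd(1)[OF a aC r]] bd(2)[OF b bC r] bd(2)[OF a aC r] by linarith
    have Du: "l2_norm (?D (unit_vec p)) \<le> \<delta>" if "p \<in> F" for p
    proof -
      obtain x l where p: "p = (x, l)" by (cases p)
      have "?D (unit_vec p) = (\<lambda>(x', k). if k = l then b x' x - a x' x else 0)"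
        by (auto simp: fun_eq_iff p amplify_def)
      then have "l2_norm (?D (unit_vec p)) \<le> l2_norm (\<lambda>x'. b x' x - a x' x)"
        using l2_slice(2)[OF l2_diff(1)[OF l2_column[OF b] l2_column[OF a]]] by simp
      also have "\<dots> < \<delta>" using b' that p by (force simp: G_def)
      finally show ?thesis by simp
    qed
    have tr: "trunc F h = (\<lambda>i. \<Sum>p\<in>F. h p * unit_vec p i)"
      using F(1) by (auto simp: fun_eq_iff trunc_def unit_vec_def if_distrib[where f="\<lambda>x. _ * x"] cong: if_cong)
    have "?D (trunc F h) = (\<lambda>i. \<Sum>p\<in>F. h p * ?D (unit_vec p) i)"
      unfolding tr mat_apply_lincomb[OF bounded_mat_amplify[OF a] l2_unit_vec]
        mat_apply_lincomb[OF bounded_mat_amplify[OF b] l2_unit_vec]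
      by (simp only: right_diff_distrib sum_subtractf)
    then have "l2_norm (?D (trunc F h)) \<le> (\<Sum>p\<in>F. l2_norm (\<lambda>i. h p * ?D (unit_vec p) i))"
      using l2_sum(2)[of F "\<lambda>p i. h p * ?D (unit_vec p) i"] l2_scale(1)[OF D[OF l2_unit_vec]] by presburger
    also have "\<dots> = (\<Sum>p\<in>F. cmod (h p) * l2_norm (?D (unit_vec p)))"
      by (intro sum.cong refl l2_scale(2) D l2_unit_vec)
    also have "\<dots> \<le> (\<Sum>p\<in>F. cmod (h p) * \<delta>)"
      by (intro sum_mono mult_left_mono Du) auto
    also have "\<dots> = S * \<delta>" by (simp add: S_def sum_distrib_right)
    finally have Dt: "l2_norm (?D (trunc F h)) \<le> S * \<delta>" .
    have hs: "h = (\<lambda>i. trunc F h i + r i)" by (simp add: r_def)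
    have "?D h = (\<lambda>i. ?D (trunc F h) i + ?D r i)"
      by (subst (1 2) hs, subst (1 2) mat_apply_add) (auto simp: bounded_mat_amplify a b r F(1))
    then have "l2_norm (?D h) \<le> l2_norm (?D (trunc F h)) + l2_norm (?D r)"
      using l2_add(2)[OF D[OF l2_trunc[OF F(1)]] D[OF r]] by simp
    also have "\<dots> \<le> S * \<delta> + 2 * C * l2_norm r" using Dt Dr by simp
    also have "\<dots> < \<epsilon>"
    proof -
      have "S * \<delta> \<le> \<epsilon> / 2" using S \<epsilon> by (simp add: \<delta>_def field_simps)
      moreover have "2 * C * l2_norm r < \<epsilon> / 2"
      proof (cases "C = 0")
        case False
        then have "2 * C * l2_norm r < 2 * C * (\<epsilon> / (4 * C + 1))"
          using C F(2) unfolding r_def by (intro mult_strict_left_mono) auto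
        also have "\<dots> \<le> \<epsilon> / 2" using C \<epsilon> by (simp add: field_simps)
        finally show ?thesis .
      qed (use \<epsilon> in auto)
      ultimately show ?thesis by linarith
    qed
    finally have "l2_norm (?D h) < \<epsilon>" .
    moreover have "(\<lambda>y. mat_apply (conj_amplify U b) f y - mat_apply (conj_amplify U a) f y) = mat_apply U (?D h)"
      by (subst mat_apply_diff[OF bU])
        (auto simp: mat_apply_conj_amplify bU a b f h_def[symmetric] intro!: l2_mat_apply bounded_mat_amplify h)
    ultimately show ?thesis by (simp add: isometry_norm[OF U] D h)
  qed
  moreover have "finite G" "\<forall>g\<in>G. l2 g" "\<delta> > 0" using F S \<epsilon> by (auto simp: G_def \<delta>_def)
  ultimately show "\<exists>G \<delta>. finite G \<and> (\<forall>g\<in>G. l2 g) \<and> 0 < \<delta> \<and>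
      (\<forall>b. uniform_roe b \<and> op_norm b \<le> C \<and> (\<forall>g\<in>G. l2_norm (\<lambda>x. mat_apply b g x - mat_apply a g x) < \<delta>) \<longrightarrow>
        l2_norm (\<lambda>y. mat_apply (conj_amplify U b) f y - mat_apply (conj_amplify U a) f y) < \<epsilon>)"
    by blast
qed

section \<open>Finitely supported matrices\<close>

definition mat_unit :: "'x \<Rightarrow> 'x \<Rightarrow> 'x \<Rightarrow> 'x \<Rightarrow> complex" where
  "mat_unit x y = (\<lambda>a b. if a = x \<and> b = y then 1 else 0)"

definition compress :: "'x set \<Rightarrow> ('x \<Rightarrow> 'x \<Rightarrow> complex) \<Rightarrow> 'x \<Rightarrow> 'x \<Rightarrow> complex" where
  "compress F a = (\<lambda>x y. if x \<in> F \<and> y \<in> F then a x y else 0)"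

lemma bounded_mat_finite_support:
  assumes F: "finite F" and M: "\<And>x y. x \<notin> F \<or> y \<notin> F \<Longrightarrow> M x y = 0"
  shows "bounded_mat M"
proof (rule mat_bound_imp_bounded_mat[where C="\<Sum>i\<in>F. l2_norm (\<lambda>j. M j i)"],
    unfold mat_bound_def, intro allI impI)
  fix f :: "'a \<Rightarrow> complex" assume f: "l2 f"
  have col: "l2 (\<lambda>j. M j i)" for i by (rule l2_norm_finite_support(1)[OF F]) (simp add: M)
  have Mf: "mat_apply M f = (\<lambda>j. \<Sum>i\<in>F. f i * M j i)"
  proof
    fix j
    have "mat_apply M f j = infsum (\<lambda>i. f i * M j i) F"
      unfolding mat_apply_def by (rule infsum_cong_neutral) (auto simp: M mult.commute)
    then show "mat_apply M f j = (\<Sum>i\<in>F. f i * M j i)" using F by simp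
  qed
  have "l2_norm (mat_apply M f) \<le> (\<Sum>i\<in>F. l2_norm (\<lambda>j. f i * M j i))"
    unfolding Mf by (intro l2_sum(2) l2_scale(1) col)
  also have "\<dots> = (\<Sum>i\<in>F. cmod (f i) * l2_norm (\<lambda>j. M j i))"
    by (intro sum.cong refl l2_scale(2) col)
  also have "\<dots> \<le> (\<Sum>i\<in>F. l2_norm f * l2_norm (\<lambda>j. M j i))"
    by (intro sum_mono mult_right_mono norm_le_l2_norm f) auto
  also have "\<dots> = (\<Sum>i\<in>F. l2_norm (\<lambda>j. M j i)) * l2_norm f"
    by (simp add: sum_distrib_left mult.commute)
  finally show "l2 (mat_apply M f) \<and> l2_norm (mat_apply M f) \<le> (\<Sum>i\<in>F. l2_norm (\<lambda>j. M j i)) * l2_norm f"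
    unfolding Mf by (auto intro: l2_lincomb col)
qed

lemma uniform_roe_finite_support:
  fixes M :: "'x::metric_space \<Rightarrow> 'x \<Rightarrow> complex"
  assumes F: "finite F" and M: "\<And>x y. x \<notin> F \<or> y \<notin> F \<Longrightarrow> M x y = 0"
  shows "uniform_roe M"
proof -
  have b: "bounded_mat M" by (rule bounded_mat_finite_support[OF F M])
  \<comment> \<open>For empty \<open>F\<close> the maximum is unspecified, but then the bound on
    distances is vacuous.\<close>
  define r where "r = Max ((\<lambda>p. dist (fst p) (snd p)) ` (F \<times> F))"
  have r: "dist x y \<le> r" if "x \<in> F" "y \<in> F" for x y
    unfolding r_def using F that by (intro Max_ge) force+
  have "finite_propagation M"
    unfolding finite_propagation_def using M r by blast
  moreover have "mat_bound (\<lambda>(x::'x) (y::'x). 0) 0"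
    by (simp add: mat_bound_def mat_apply_def)
  then have "op_norm (\<lambda>x y. M x y - M x y) \<le> 0"
    using op_norm_le by simp
  ultimately show ?thesis unfolding uniform_roe_def using b by (meson le_less_trans)
qed

lemma uniform_roe_compress:
  fixes a :: "'x::metric_space \<Rightarrow> 'x \<Rightarrow> complex"
  shows "finite F \<Longrightarrow> uniform_roe (compress F a)"
  by (rule uniform_roe_finite_support[of F]) (auto simp: compress_def)

lemma uniform_roe_mat_unit: "uniform_roe (mat_unit x (y::'x::metric_space))"
  by (rule uniform_roe_finite_support[of "{x, y}"]) (auto simp: mat_unit_def)

lemma mat_apply_compress: "mat_apply (compress F a) f = trunc F (mat_apply a (trunc F f))"
  unfolding mat_apply_def trunc_def compress_def by (auto simp: fun_eq_iff intro!: infsum_cong)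

lemma op_norm_compress:
  assumes "bounded_mat a" "finite F"
  shows "op_norm (compress F a) \<le> op_norm a"
proof (rule op_norm_le, unfold mat_bound_def mat_apply_compress, intro allI impI conjI)
  fix f :: "'a \<Rightarrow> complex" assume f: "l2 f"
  have t: "l2 (trunc F f)" using assms(2) by simp
  have "l2_norm (trunc F (mat_apply a (trunc F f))) \<le> l2_norm (mat_apply a (trunc F f))"
    by (rule l2_norm_trunc_le[OF assms(2) l2_mat_apply[OF assms(1) t]])
  also have "\<dots> \<le> op_norm a * l2_norm (trunc F f)" by (rule l2_norm_mat_apply[OF assms(1) t])
  also have "\<dots> \<le> op_norm a * l2_norm f"
    by (rule mult_left_mono[OF l2_norm_trunc_le[OF assms(2) f] op_norm_nonneg[OF assms(1)]])
  finally show "l2_norm (trunc F (mat_apply a (trunc F f))) \<le> op_norm a * l2_norm f" .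
qed (simp add: assms)

text \<open>Two errors occur: cutting \<open>g\<close> before applying \<open>a\<close>, which costs
  at most \<open>op_norm a\<close> times the tail of \<open>g\<close>, and cutting the image
  afterwards, which costs the tail of \<open>mat_apply a g\<close>. Each is made smaller than half
  of \<open>\<delta>\<close>.\<close>

lemma eventually_compress_close:
  assumes a: "bounded_mat a" and g: "l2 g" and \<delta>: "\<delta> > 0"
  shows "\<forall>\<^sub>F F in finite_subsets_at_top UNIV.
    l2_norm (\<lambda>x. mat_apply (compress F a) g x - mat_apply a g x) < \<delta>"
proof -
  define K where "K = op_norm a + 1"
  have K: "K > 0" using op_norm_nonneg[OF a] by (simp add: K_def)
  have ag: "l2 (mat_apply a g)" by (rule l2_mat_apply[OF a g])
  have "\<forall>\<^sub>F F in finite_subsets_at_top UNIV. l2_norm (\<lambda>i. g i - trunc F g i) < \<delta> / (2 * K)"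
    using \<delta> K by (intro eventually_trunc_close g) simp
  moreover have "\<forall>\<^sub>F F in finite_subsets_at_top UNIV.
      l2_norm (\<lambda>i. mat_apply a g i - trunc F (mat_apply a g) i) < \<delta> / 2"
    using \<delta> by (intro eventually_trunc_close ag) simp
  moreover have "\<forall>\<^sub>F F in finite_subsets_at_top (UNIV::'a set). finite F"
    by (auto simp: eventually_finite_subsets_at_top)
  ultimately show ?thesis
  proof eventually_elim
    case (elim F)
    let ?d = "\<lambda>i. g i - trunc F g i" and ?e = "\<lambda>i. mat_apply a g i - trunc F (mat_apply a g) i"
    have d: "l2 ?d" using elim g by (intro l2_diff) auto
    have e: "l2 ?e" using elim ag by (intro l2_diff) auto
    have td: "l2 (trunc F (mat_apply a ?d))" using elim by simp
    \<comment> \<open>The term \<open>trunc F (mat_apply a g)\<close> is inserted between the two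
      vectors; the overall sign disappears in the norm.\<close>
    have "(\<lambda>x. mat_apply (compress F a) g x - mat_apply a g x) =
        (\<lambda>x. -1 * (trunc F (mat_apply a ?d) x + ?e x))"
      using elim by (auto simp: fun_eq_iff mat_apply_compress mat_apply_diff[OF a g] trunc_def[of F "mat_apply a _"]
          trunc_def[of F "\<lambda>j. mat_apply a _ j - _ j"])
    then have "l2_norm (\<lambda>x. mat_apply (compress F a) g x - mat_apply a g x)
        = l2_norm (\<lambda>x. trunc F (mat_apply a ?d) x + ?e x)"
      using l2_scale(2)[OF l2_add(1)[OF td e], of "-1"] by simp
    also have "\<dots> \<le> l2_norm (trunc F (mat_apply a ?d)) + l2_norm ?e" by (rule l2_add(2)[OF td e])
    also have "l2_norm (trunc F (mat_apply a ?d)) \<le> l2_norm (mat_apply a ?d)"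
      using elim by (intro l2_norm_trunc_le l2_mat_apply a d)
    also have "\<dots> \<le> op_norm a * l2_norm ?d" by (rule l2_norm_mat_apply[OF a d])
    also have "\<dots> \<le> K * l2_norm ?d" by (simp add: K_def mult_right_mono)
    also have "\<dots> < \<delta> / 2" using elim(1) K by (simp add: field_simps)
    finally show ?case using elim(2) by simp
  qed
qed

text \<open>All corners of \<open>a\<close> stay in the ball of radius \<open>op_norm a\<close>,
  where continuity of both maps applies. A single large \<open>F\<close> puts the corner into both
  neighbourhoods of \<open>a\<close>, and at that corner the maps agree.\<close>

lemma strongly_continuous_eqI:
  fixes \<Phi> \<Psi> :: "('x::metric_space \<Rightarrow> 'x \<Rightarrow> complex) \<Rightarrow> 'y \<Rightarrow> 'y \<Rightarrow> complex"
  assumes cont: "strongly_continuous \<Phi>" "strongly_continuous \<Psi>"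
    and bdd: "\<And>a. uniform_roe a \<Longrightarrow> bounded_mat (\<Phi> a)" "\<And>a. uniform_roe a \<Longrightarrow> bounded_mat (\<Psi> a)"
    and eq: "\<And>F. finite F \<Longrightarrow> \<Phi> (compress F a) = \<Psi> (compress F a)"
    and a: "uniform_roe a"
  shows "\<Phi> a = \<Psi> a"
proof (rule mat_eqI)
  fix i :: 'y
  let ?f = "unit_vec i"
  have f: "l2 ?f" by simp
  note ba = uniform_roe_bounded[OF a]
  let ?d = "\<lambda>j. mat_apply (\<Phi> a) ?f j - mat_apply (\<Psi> a) ?f j"
  have l2\<Phi>: "l2 (mat_apply (\<Phi> b) ?f)" and l2\<Psi>: "l2 (mat_apply (\<Psi> b) ?f)" if "uniform_roe b" for b
    using l2_mat_apply[OF bdd(1)[OF that] f] l2_mat_apply[OF bdd(2)[OF that] f] by auto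
  have "l2_norm ?d \<le> 0 + \<epsilon>" if "\<epsilon> > 0" for \<epsilon>
  proof -
    have e2: "\<epsilon> / 2 > 0" using that by simp
    obtain G \<delta> where G: "finite G" "\<forall>g\<in>G. l2 g" "\<delta> > 0" and
      cG: "\<And>b. uniform_roe b \<Longrightarrow> op_norm b \<le> op_norm a \<Longrightarrow>
        (\<forall>g\<in>G. l2_norm (\<lambda>x. mat_apply b g x - mat_apply a g x) < \<delta>) \<Longrightarrow>
        l2_norm (\<lambda>y. mat_apply (\<Phi> b) ?f y - mat_apply (\<Phi> a) ?f y) < \<epsilon> / 2"
      using cont(1)[unfolded strongly_continuous_def, rule_format, of a "op_norm a" ?f "\<epsilon> / 2"] a f e2
      by blast
    obtain H \<eta> where H: "finite H" "\<forall>g\<in>H. l2 g" "\<eta> > 0" and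
      cH: "\<And>b. uniform_roe b \<Longrightarrow> op_norm b \<le> op_norm a \<Longrightarrow>
        (\<forall>g\<in>H. l2_norm (\<lambda>x. mat_apply b g x - mat_apply a g x) < \<eta>) \<Longrightarrow>
        l2_norm (\<lambda>y. mat_apply (\<Psi> b) ?f y - mat_apply (\<Psi> a) ?f y) < \<epsilon> / 2"
      using cont(2)[unfolded strongly_continuous_def, rule_format, of a "op_norm a" ?f "\<epsilon> / 2"] a f e2
      by blast
    have "\<forall>\<^sub>F F in finite_subsets_at_top UNIV. \<forall>g\<in>G. l2_norm (\<lambda>x. mat_apply (compress F a) g x - mat_apply a g x) < \<delta>"
      using G by (intro eventually_ball_finite ballI eventually_compress_close ba) auto
    moreover have "\<forall>\<^sub>F F in finite_subsets_at_top UNIV. \<forall>g\<in>H. l2_norm (\<lambda>x. mat_apply (compress F a) g x - mat_apply a g x) < \<eta>"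
      using H by (intro eventually_ball_finite ballI eventually_compress_close ba) auto
    moreover have "\<forall>\<^sub>F F in finite_subsets_at_top (UNIV::'x set). finite F"
      by (auto simp: eventually_finite_subsets_at_top)
    ultimately have "\<forall>\<^sub>F F in finite_subsets_at_top UNIV. finite F \<and>
        (\<forall>g\<in>G. l2_norm (\<lambda>x. mat_apply (compress F a) g x - mat_apply a g x) < \<delta>) \<and>
        (\<forall>g\<in>H. l2_norm (\<lambda>x. mat_apply (compress F a) g x - mat_apply a g x) < \<eta>)"
      by eventually_elim blast
    from eventually_happens'[OF finite_subsets_at_top_neq_bot this] obtain F where F: "finite F"
        "\<forall>g\<in>G. l2_norm (\<lambda>x. mat_apply (compress F a) g x - mat_apply a g x) < \<delta>"
        "\<forall>g\<in>H. l2_norm (\<lambda>x. mat_apply (compress F a) g x - mat_apply a g x) < \<eta>"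
      by (elim exE conjE)
    define b where "b = compress F a"
    have b: "uniform_roe b" "op_norm b \<le> op_norm a"
      unfolding b_def using uniform_roe_compress[OF F(1)] op_norm_compress[OF ba F(1)] by auto
    let ?p = "\<lambda>y. mat_apply (\<Psi> b) ?f y - mat_apply (\<Psi> a) ?f y"
    let ?q = "\<lambda>y. mat_apply (\<Phi> b) ?f y - mat_apply (\<Phi> a) ?f y"
    \<comment> \<open>The values of the two maps at \<open>b\<close> coincide and cancel.\<close>
    have "?d = (\<lambda>j. ?p j - ?q j)" using eq[OF F(1)] by (simp add: b_def)
    then have "l2_norm ?d \<le> l2_norm ?p + l2_norm ?q"
      using l2_diff(2)[OF l2_diff(1)[OF l2\<Psi>[OF b(1)] l2\<Psi>[OF a]] l2_diff(1)[OF l2\<Phi>[OF b(1)] l2\<Phi>[OF a]]]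
      by simp
    also have "\<dots> \<le> \<epsilon>"
      using cG[OF b F(2)[folded b_def]] cH[OF b F(3)[folded b_def]] by linarith
    finally show ?thesis by simp
  qed
  then have "l2_norm ?d \<le> 0" by (rule field_le_epsilon)
  then have "l2_norm ?d = 0" using l2_norm_nonneg[of ?d] by linarith
  moreover have "l2 ?d" by (rule l2_diff(1)[OF l2\<Phi>[OF a] l2\<Psi>[OF a]])
  ultimately have "?d = (\<lambda>j. 0)" using l2_norm_eq_0_iff by blast
  then show "mat_apply (\<Phi> a) ?f = mat_apply (\<Psi> a) ?f" by (auto simp: fun_eq_iff)
qed

section \<open>Matrix units and linear combinations of them\<close>

lemma compress_as_sum:
  assumes "finite F"
  shows "compress F a = (\<lambda>u v. \<Sum>p\<in>F \<times> F. a (fst p) (snd p) * mat_unit (fst p) (snd p) u v)"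
proof (intro ext)
  fix u v
  have "(\<Sum>p\<in>F \<times> F. a (fst p) (snd p) * mat_unit (fst p) (snd p) u v)
      = (\<Sum>p\<in>F \<times> F. if p = (u, v) then a u v else 0)"
    by (intro sum.cong) (auto simp: mat_unit_def)
  then show "compress F a u v = (\<Sum>p\<in>F \<times> F. a (fst p) (snd p) * mat_unit (fst p) (snd p) u v)"
    using assms by (simp add: compress_def)
qed

lemma mat_apply_unit: "mat_apply (mat_unit x y) f = (\<lambda>z. if z = x then f y else 0)"
proof
  fix z
  have "mat_apply (mat_unit x y) f z = infsum (\<lambda>i. mat_unit x y z i * f i) {y}"
    unfolding mat_apply_def by (rule infsum_cong_neutral) (auto simp: mat_unit_def)
  then show "mat_apply (mat_unit x y) f z = (if z = x then f y else 0)" by (simp add: mat_unit_def)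
qed

lemma mat_unit_mult: "mat_mult (mat_unit x y) (mat_unit z w) = (if y = z then mat_unit x w else (\<lambda>_ _. 0))"
  by (auto simp: fun_eq_iff mat_mult_entry mat_apply_unit) (auto simp: mat_unit_def)

lemma mat_unit_adj: "mat_adj (mat_unit x y) = mat_unit y x"
  by (auto simp: fun_eq_iff mat_adj_def mat_unit_def)

lemma has_rank_mat_unit: "has_rank (mat_unit x x) 1"
proof -
  have "rank_at_least (mat_unit x x) 1"
    unfolding rank_at_least_def
  proof (intro exI[of _ "\<lambda>_. unit_vec x"] conjI)
    show "lin_indep_vecs (\<lambda>m. mat_apply (mat_unit x x) (unit_vec x)) 1"
      unfolding lin_indep_vecs_def mat_apply_unit by (auto simp: unit_vec_def)
  qed auto
  moreover have "k \<le> 1" if rk: "rank_at_least (mat_unit x x) k" for k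
  proof -
    obtain v where "lin_indep_vecs (\<lambda>m. mat_apply (mat_unit x x) (v m)) k"
      using rk unfolding rank_at_least_def by blast
    then have "k \<le> card {x}"
      by (rule lin_indep_le_card_span[where A="\<lambda>m l. v m l" and s=unit_vec])
        (auto simp: mat_apply_unit unit_vec_def)
    then show ?thesis by simp
  qed
  ultimately show ?thesis
    unfolding has_rank_def one_enat_def using rank_at_least_mono by auto
qed

lemma mat_apply_lincomb_left:
  assumes "\<And>p. p \<in> P \<Longrightarrow> bounded_mat (m p)" "l2 f"
  shows "mat_apply (\<lambda>j i. \<Sum>p\<in>P. c p * m p j i) f = (\<lambda>j. \<Sum>p\<in>P. c p * mat_apply (m p) f j)"
  using assms cip_lincomb_left[of f P "\<lambda>p i. cnj (m p j i)" "\<lambda>p. cnj (c p)" for j]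
  by (simp add: mat_apply_as_cip fun_eq_iff l2_row)

lemma conj_amplify_lincomb:
  assumes U: "bounded_mat U" and m: "\<And>p. p \<in> P \<Longrightarrow> bounded_mat (m p)"
    and s: "bounded_mat (\<lambda>u v. \<Sum>p\<in>P. c p * m p u v)"
  shows "conj_amplify U (\<lambda>u v. \<Sum>p\<in>P. c p * m p u v) = (\<lambda>u v. \<Sum>p\<in>P. c p * conj_amplify U (m p) u v)"
proof (rule mat_eqI)
  fix i
  let ?g = "mat_apply (mat_adj U) (unit_vec i)"
  have g: "l2 ?g" by (rule l2_mat_apply[OF bounded_mat_adj[OF U] l2_unit_vec])
  have "amplify (\<lambda>u v. \<Sum>p\<in>P. c p * m p u v) = (\<lambda>q r. \<Sum>p\<in>P. c p * amplify (m p) q r)"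
    by (auto simp: fun_eq_iff amplify_def)
  then have "mat_apply (conj_amplify U (\<lambda>u v. \<Sum>p\<in>P. c p * m p u v)) (unit_vec i)
      = mat_apply U (mat_apply (\<lambda>q r. \<Sum>p\<in>P. c p * amplify (m p) q r) ?g)"
    unfolding mat_apply_conj_amplify[OF U s l2_unit_vec] by (rule arg_cong)
  also have "\<dots> = (\<lambda>j. \<Sum>p\<in>P. c p * mat_apply U (mat_apply (amplify (m p)) ?g) j)"
    by (simp add: mat_apply_lincomb_left bounded_mat_amplify m g mat_apply_lincomb U l2_mat_apply del: mat_apply_unit_vec)
  also have "\<dots> = (\<lambda>j. \<Sum>p\<in>P. c p * mat_apply (conj_amplify U (m p)) (unit_vec i) j)"
    by (simp add: mat_apply_conj_amplify U m del: mat_apply_unit_vec)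
  finally show "mat_apply (conj_amplify U (\<lambda>u v. \<Sum>p\<in>P. c p * m p u v)) (unit_vec i)
      = mat_apply (\<lambda>u v. \<Sum>p\<in>P. c p * conj_amplify U (m p) u v) (unit_vec i)"
    by simp
qed

text \<open>The amplified unit maps the slice over \<open>x'\<close> identically to the slice over
  \<open>x\<close> and kills the rest, so the double series for the entry collapses to one over
  \<open>l\<close>. This is the shape that Parseval's identity will match.\<close>

lemma conj_amplify_mat_unit:
  assumes U: "bounded_mat U"
  shows "conj_amplify U (mat_unit x x') y y' = (\<Sum>\<^sub>\<infinity>l. U y (x, l) * cnj (U y' (x', l)))"
proof -
  have b: "bounded_mat (mat_unit x x')"
    by (rule bounded_mat_finite_support[of "{x, x'}"]) (auto simp: mat_unit_def)
  let ?g = "mat_apply (amplify (mat_unit x x')) (mat_apply (mat_adj U) (unit_vec y'))"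
  have g: "?g (z, k) = (if z = x then cnj (U y' (x', k)) else 0)" for z k
    by (simp add: mat_apply_amplify mat_apply_unit mat_adj_def)
  have "conj_amplify U (mat_unit x x') y y' = mat_apply (conj_amplify U (mat_unit x x')) (unit_vec y') y"
    by simp
  also have "\<dots> = mat_apply U ?g y" by (simp only: mat_apply_conj_amplify[OF U b l2_unit_vec])
  also have "\<dots> = infsum (\<lambda>p. U y p * ?g p) (range (\<lambda>l. (x, l)))"
    unfolding mat_apply_def[of U] by (rule infsum_cong_neutral) (auto simp: g image_iff simp del: mat_apply_unit_vec split: if_splits)
  also have "\<dots> = (\<Sum>\<^sub>\<infinity>l. U y (x, l) * cnj (U y' (x', l)))"
    by (subst infsum_reindex) (auto simp: inj_on_def o_def g simp del: mat_apply_unit_vec)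
  finally show ?thesis .
qed

section \<open>Gram-Schmidt\<close>

text \<open>The congruence rule exposes \<open>m < n\<close> to the recursive calls under the sum,
  which termination depends on.\<close>

context
  notes sum.cong [fundef_cong]
begin

text \<open>If the residual vanishes, the division by its norm returns the zero vector.\<close>

function gram_schmidt :: "(nat \<Rightarrow> 'j \<Rightarrow> complex) \<Rightarrow> nat \<Rightarrow> 'j \<Rightarrow> complex" where
  "gram_schmidt v n = (let r = (\<lambda>j. v n j - (\<Sum>m<n. cip (gram_schmidt v m) (v n) * gram_schmidt v m j))
     in (\<lambda>j. of_real (1 / l2_norm r) * r j))"
  by auto
termination by (relation "Wellfounded.measure snd") auto

end

declare gram_schmidt.simps [simp del]

context
  fixes v :: "nat \<Rightarrow> 'j \<Rightarrow> complex"
  assumes v: "\<And>n. l2 (v n)"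
begin

private abbreviation "w \<equiv> gram_schmidt v"

private definition "res n = (\<lambda>j. v n j - (\<Sum>m<n. cip (w m) (v n) * w m j))"

private lemma w_eq: "w n = (\<lambda>j. of_real (1 / l2_norm (res n)) * res n j)"
  by (subst gram_schmidt.simps) (simp only: Let_def res_def)

private lemma l2_res: "(\<And>m. m < n \<Longrightarrow> l2 (w m)) \<Longrightarrow> l2 (res n)"
  unfolding res_def by (intro l2_diff l2_lincomb v) auto

lemma l2_gram_schmidt: "l2 (gram_schmidt v n)"
proof (induction n rule: less_induct)
  case (less n)
  then have "l2 (res n)" by (rule l2_res)
  then show ?case unfolding w_eq by (rule l2_scale)
qed

private lemma l2_res': "l2 (res n)"
  by (rule l2_res) (rule l2_gram_schmidt)

text \<open>The family \<open>v\<close> may be dependent, so zero vectors can occur in the output.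
  They are carried along, and later removed by restricting the index set.\<close>

private lemma w_cases: "(res n = (\<lambda>j. 0) \<and> w n = (\<lambda>j. 0)) \<or> (l2_norm (res n) > 0 \<and> l2_norm (w n) = 1)"
proof (cases "l2_norm (res n) = 0")
  case True
  then have "res n = (\<lambda>j. 0)" using l2_norm_eq_0_iff[OF l2_res'] by simp
  then show ?thesis by (simp add: w_eq)
next
  case False
  then have "l2_norm (w n) = 1"
    unfolding w_eq by (subst l2_scale(2)[OF l2_res']) (simp add: norm_divide)
  then show ?thesis using False l2_norm_nonneg[of "res n"] by linarith
qed

lemma gram_schmidt_norm: "gram_schmidt v n \<noteq> (\<lambda>j. 0) \<Longrightarrow> cip (gram_schmidt v n) (gram_schmidt v n) = 1"
  using w_cases[of n] by (auto simp: cip_same[OF l2_gram_schmidt])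

private lemma orth_less: "m < n \<Longrightarrow> cip (w m) (w n) = 0"
proof (induction n arbitrary: m rule: less_induct)
  case (less n)
  have orth: "cip (w m) (w m') = 0" if "m' < n" "m' \<noteq> m" for m'
  proof (cases "m' < m")
    case True
    then show ?thesis using less.IH[of m m'] less.prems by (subst cip_commute) simp
  qed (use less.IH[of m' m] that in auto)
  have "cip (w m) (res n) = cip (w m) (v n) - (\<Sum>m'<n. cip (w m') (v n) * cip (w m) (w m'))"
    unfolding res_def
    by (subst cip_diff_right) (auto simp: l2_gram_schmidt v l2_lincomb cip_lincomb_right)
  also have "(\<Sum>m'<n. cip (w m') (v n) * cip (w m) (w m'))
      = (\<Sum>m'<n. if m' = m then cip (w m) (v n) * cip (w m) (w m) else 0)"
    by (intro sum.cong) (auto simp: orth)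
  also have "\<dots> = cip (w m) (v n) * cip (w m) (w m)" using less.prems by simp
  \<comment> \<open>If \<open>w m\<close> is the zero vector both sides vanish; otherwise its
    self-pairing is 1.\<close>
  also have "\<dots> = cip (w m) (v n)"
    using gram_schmidt_norm[of m] by (cases "w m = (\<lambda>j. 0)") auto
  finally have "cip (w m) (res n) = 0" by simp
  then show ?case by (subst (2) w_eq) (simp only: cip_scale_right mult_zero_right)
qed

lemma gram_schmidt_orthogonal: "m \<noteq> n \<Longrightarrow> cip (gram_schmidt v m) (gram_schmidt v n) = 0"
  using orth_less[of m n] orth_less[of n m] cip_commute[of "w n" "w m"] by (cases "m < n") auto

text \<open>By orthogonality the coefficient at \<open>n\<close> equals the norm of the residual, so
  the last term restores the residual. When the residual is zero, that coefficient is zero as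
  well.\<close>

lemma gram_schmidt_expand: "v n = (\<lambda>j. \<Sum>m\<le>n. cip (gram_schmidt v m) (v n) * gram_schmidt v m j)"
proof -
  have vn: "v n = (\<lambda>j. res n j + (\<Sum>m<n. cip (w m) (v n) * w m j))" by (simp add: res_def)
  have "cip (w n) (v n) = cip (w n) (res n) + (\<Sum>m<n. cip (w m) (v n) * cip (w n) (w m))"
    by (subst vn, subst cip_add_right) (auto simp: l2_gram_schmidt l2_res' l2_lincomb cip_lincomb_right)
  also have "(\<Sum>m<n. cip (w m) (v n) * cip (w n) (w m)) = 0"
    by (intro sum.neutral) (auto simp: gram_schmidt_orthogonal)
  finally have c: "cip (w n) (v n) = cip (w n) (res n)" by simp
  have "res n = (\<lambda>j. cip (w n) (v n) * w n j)"
  proof (cases "res n = (\<lambda>j. 0)")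
    case False
    then have pos: "l2_norm (res n) > 0" and nz: "w n \<noteq> (\<lambda>j. 0)"
      using w_cases[of n] by auto
    have r: "res n = (\<lambda>j. of_real (l2_norm (res n)) * w n j)"
      using pos by (simp add: w_eq)
    have "cip (w n) (res n) = of_real (l2_norm (res n)) * cip (w n) (w n)"
      by (subst r) (rule cip_scale_right)
    then have "cip (w n) (v n) = of_real (l2_norm (res n))" using c gram_schmidt_norm[OF nz] by simp
    with r show ?thesis by simp
  qed (use c in simp)
  then have "v n j = (\<Sum>m\<le>n. cip (w m) (v n) * w m j)" for j
    using fun_cong[OF vn, of j] by (simp add: lessThan_Suc_atMost[symmetric] fun_eq_iff)
  then show ?thesis by blast
qed

lemma gram_schmidt_cip_later: "n < m \<Longrightarrow> cip (gram_schmidt v m) (v n) = 0"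
  by (subst gram_schmidt_expand)
    (auto simp: cip_lincomb_right l2_gram_schmidt gram_schmidt_orthogonal intro!: sum.neutral)

text \<open>A finite sum in disguise: terms beyond \<open>n\<close> vanish by orthogonality and zero
  vectors contribute nothing. Stating it over the nonzero indices gives one index set that serves
  all \<open>n\<close>.\<close>

lemma gram_schmidt_parseval:
  assumes "l2 f"
  shows "((\<lambda>m. cip f (gram_schmidt v m) * cip (gram_schmidt v m) (v n)) has_sum cip f (v n))
    {m. gram_schmidt v m \<noteq> (\<lambda>j. 0)}"
proof -
  have "cip f (v n) = (\<Sum>m\<le>n. cip f (w m) * cip (w m) (v n))"
    by (subst gram_schmidt_expand, subst cip_lincomb_right)
      (auto simp: l2_gram_schmidt assms mult.commute intro!: sum.cong)
  then have "((\<lambda>m. cip f (w m) * cip (w m) (v n)) has_sum cip f (v n)) {..n}"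
    by (simp add: has_sum_finite)
  moreover have "((\<lambda>m. cip f (w m) * cip (w m) (v n)) has_sum cip f (v n)) {..n} \<longleftrightarrow>
      ((\<lambda>m. cip f (w m) * cip (w m) (v n)) has_sum cip f (v n)) {m. w m \<noteq> (\<lambda>j. 0)}"
    by (rule has_sum_cong_neutral) (auto simp: gram_schmidt_cip_later not_le)
  ultimately show ?thesis by simp
qed

lemma gram_schmidt_fixed:
  assumes p: "bounded_mat p" and fix_v: "\<And>n. mat_apply p (v n) = v n"
  shows "mat_apply p (gram_schmidt v n) = gram_schmidt v n"
proof (induction n rule: less_induct)
  case (less n)
  have "mat_apply p (res n) = res n"
    unfolding res_def
    by (subst mat_apply_diff[OF p])
      (auto simp: v l2_lincomb l2_gram_schmidt fix_v mat_apply_lincomb[OF p] less.IH intro!: sum.cong)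
  then show ?case by (subst (1 2) w_eq) (simp only: mat_apply_scale)
qed

end

section \<open>Embeddings of uniform Roe algebras\<close>

text \<open>Balls of integer radius about one point are finite and cover the space.\<close>

lemma unif_locally_finite_countable:
  assumes "unif_locally_finite TYPE('x::metric_space)"
  shows "countable (UNIV :: 'x set)"
proof -
  have "UNIV = (\<Union>n::nat. cball (undefined::'x) (real n))"
    by (auto simp: real_arch_simple)
  moreover have "countable (cball (undefined::'x) r)" for r
    using assms unfolding unif_locally_finite_def by (meson countable_finite)
  then have "countable (\<Union>n::nat. cball (undefined::'x) (real n))" by (intro countable_UN) auto
  ultimately show ?thesis by simp
qed

text \<open>Vectors fixed by \<open>p\<close> are their own images, so independence of the images is
  independence of an orthonormal family.\<close>

lemma rank_at_least_orthonormal: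
  assumes w: "\<And>m. m \<in> K \<Longrightarrow> l2 (w m)"
    and on: "\<And>m n. m \<in> K \<Longrightarrow> n \<in> K \<Longrightarrow> cip (w m) (w n) = (if m = n then 1 else 0)"
    and fixed: "\<And>m. m \<in> K \<Longrightarrow> mat_apply p (w m) = w m" and K: "finite K"
  shows "rank_at_least p (card K)"
proof -
  obtain e where e: "bij_betw e {..<card K} K"
    using ex_bij_betw_nat_finite[OF K] by (auto simp: atLeast0LessThan)
  then have eK: "e m \<in> K" if "m < card K" for m using that by (auto simp: bij_betw_def)
  have "lin_indep_vecs (\<lambda>m. mat_apply p (w (e m))) (card K)"
    unfolding lin_indep_vecs_def
  proof (intro allI impI)
    fix c :: "nat \<Rightarrow> complex" and m
    assume c: "\<forall>j. (\<Sum>m<card K. c m * mat_apply p (w (e m)) j) = 0" and m: "m < card K"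
    have "(\<lambda>j. \<Sum>m<card K. c m * w (e m) j) = (\<lambda>j. 0)"
      using c by (simp add: fixed eK)
    then have "0 = cip (w (e m)) (\<lambda>j. \<Sum>m<card K. c m * w (e m) j)" by simp
    also have "\<dots> = (\<Sum>m'<card K. c m' * cip (w (e m)) (w (e m')))"
      by (rule cip_lincomb_right) (auto simp: w eK m)
    also have "\<dots> = (\<Sum>m'<card K. if m' = m then c m else 0)"
      using e m by (intro sum.cong) (auto simp: on eK bij_betw_def inj_on_def)
    finally show "c m = 0" using m by simp
  qed
  then show ?thesis
    unfolding rank_at_least_def by (intro exI[of _ "\<lambda>m. w (e m)"]) (auto simp: w eK)
qed

section \<open>Images of matrix units under an embedding\<close>

context
  fixes \<Phi> :: "('x::metric_space \<Rightarrow> 'x \<Rightarrow> complex) \<Rightarrow> ('y::metric_space \<Rightarrow> 'y \<Rightarrow> complex)"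
  assumes emb: "roe_embedding \<Phi>"
begin

lemma embedding_roe: "uniform_roe a \<Longrightarrow> uniform_roe (\<Phi> a)"
  using emb unfolding roe_embedding_def by blast

lemma embedding_bounded: "uniform_roe a \<Longrightarrow> bounded_mat (\<Phi> a)"
  by (rule uniform_roe_bounded[OF embedding_roe])

lemma embedding_add:
  "uniform_roe a \<Longrightarrow> uniform_roe b \<Longrightarrow> \<Phi> (\<lambda>x y. a x y + b x y) = (\<lambda>x y. \<Phi> a x y + \<Phi> b x y)"
  using emb unfolding roe_embedding_def by blast

lemma embedding_scale: "uniform_roe a \<Longrightarrow> \<Phi> (\<lambda>x y. c * a x y) = (\<lambda>x y. c * \<Phi> a x y)"
  using emb unfolding roe_embedding_def by blast

lemma embedding_mult: "uniform_roe a \<Longrightarrow> uniform_roe b \<Longrightarrow> mat_mult (\<Phi> a) (\<Phi> b) = \<Phi> (mat_mult a b)"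
  using emb unfolding roe_embedding_def by metis

lemma embedding_adj: "uniform_roe a \<Longrightarrow> mat_adj (\<Phi> a) = \<Phi> (mat_adj a)"
  using emb unfolding roe_embedding_def by metis

lemma embedding_zero: "\<Phi> (\<lambda>_ _. 0) = (\<lambda>_ _. 0)"
  using embedding_scale[OF uniform_roe_mat_unit, of 0] by simp

lemma embedding_unit_adj: "mat_adj (\<Phi> (mat_unit x y)) = \<Phi> (mat_unit y x)"
  by (simp add: embedding_adj uniform_roe_mat_unit mat_unit_adj)

lemma embedding_unit_apply_apply:
  assumes "l2 f"
  shows "mat_apply (\<Phi> (mat_unit x y)) (mat_apply (\<Phi> (mat_unit z t)) f)
    = (if y = z then mat_apply (\<Phi> (mat_unit x t)) f else (\<lambda>_. 0))"
proof -
  have "mat_apply (\<Phi> (mat_unit x y)) (mat_apply (\<Phi> (mat_unit z t)) f)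
      = mat_apply (\<Phi> (mat_mult (mat_unit x y) (mat_unit z t))) f"
    by (simp only: mat_apply_mult[symmetric] embedding_bounded uniform_roe_mat_unit assms embedding_mult)
  then show ?thesis by (simp add: mat_unit_mult embedding_zero mat_apply_def)
qed

lemma embedding_unit_cip:
  assumes "l2 f" "l2 g"
  shows "cip (mat_apply (\<Phi> (mat_unit x y)) f) g = cip f (mat_apply (\<Phi> (mat_unit y x)) g)"
  using cip_mat_apply[OF embedding_bounded[OF uniform_roe_mat_unit[of y x]] assms(2,1)]
  by (simp add: embedding_unit_adj)

text \<open>The source of all orthogonality: images of units in different rows have orthogonal
  ranges, and for \<open>y = t = b\<close> and equal rows the inner product of vectors in the range
  of \<open>\<Phi> (mat_unit b b)\<close> is preserved.\<close>

lemma embedding_unit_cip_cip: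
  assumes "l2 f" "l2 g"
  shows "cip (mat_apply (\<Phi> (mat_unit x y)) f) (mat_apply (\<Phi> (mat_unit z t)) g)
    = (if x = z then cip f (mat_apply (\<Phi> (mat_unit y t)) g) else 0)"
  by (simp add: embedding_unit_cip assms l2_mat_apply embedding_bounded uniform_roe_mat_unit
      embedding_unit_apply_apply)

lemma embedding_lincomb_units:
  assumes "finite P"
  shows "\<Phi> (\<lambda>u v. \<Sum>p\<in>P. c p * mat_unit (fst p) (snd p) u v)
    = (\<lambda>u v. \<Sum>p\<in>P. c p * \<Phi> (mat_unit (fst p) (snd p)) u v)"
  using assms
proof (induction P)
  case empty
  then show ?case by (simp add: embedding_zero)
next
  case (insert q P)
  let ?S = "\<lambda>u v. \<Sum>p\<in>P. c p * mat_unit (fst p) (snd p) u v"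
  \<comment> \<open>Additivity of the embedding is given on the algebra, so the partial sum has to
    be placed there before the next term is split off.\<close>
  have S: "uniform_roe ?S"
    by (rule uniform_roe_finite_support[of "fst ` P \<union> snd ` P"])
      (use insert.hyps in \<open>auto simp: mat_unit_def image_iff intro!: sum.neutral\<close>)
  have q: "uniform_roe (\<lambda>u v. c q * mat_unit (fst q) (snd q) u v)"
    by (rule uniform_roe_finite_support[of "{fst q, snd q}"]) (auto simp: mat_unit_def)
  have "\<Phi> (\<lambda>u v. c q * mat_unit (fst q) (snd q) u v + ?S u v)
      = (\<lambda>u v. \<Phi> (\<lambda>u v. c q * mat_unit (fst q) (snd q) u v) u v + \<Phi> ?S u v)"
    by (rule embedding_add[OF q S])
  then show ?case
    using insert by (simp add: embedding_scale uniform_roe_mat_unit)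
qed

lemma embedding_eq_conj_amplify:
  fixes U :: "'y \<Rightarrow> 'x \<times> 'k \<Rightarrow> complex"
  assumes cont: "strongly_continuous \<Phi>" and U: "isometry_mat U"
    and units: "\<And>x y. \<Phi> (mat_unit x y) = conj_amplify U (mat_unit x y)"
    and a: "uniform_roe a"
  shows "\<Phi> a = conj_amplify U a"
proof (rule strongly_continuous_eqI[OF cont conj_amplify_strongly_continuous[OF U] _ _ _ a])
  note bU = isometry_bounded[OF U]
  show "bounded_mat (\<Phi> a)" if "uniform_roe a" for a using that by (rule embedding_bounded)
  show "bounded_mat (conj_amplify U a)" if "uniform_roe a" for a
    using bU uniform_roe_bounded[OF that] by (rule bounded_conj_amplify)
  fix F :: "'x set" assume F: "finite F"
  have "bounded_mat (compress F a)" by (rule uniform_roe_bounded[OF uniform_roe_compress[OF F]])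
  then have "conj_amplify U (compress F a)
      = (\<lambda>u v. \<Sum>p\<in>F \<times> F. a (fst p) (snd p) * conj_amplify U (mat_unit (fst p) (snd p)) u v)"
    unfolding compress_as_sum[OF F]
    by (rule conj_amplify_lincomb[OF bU uniform_roe_bounded[OF uniform_roe_mat_unit]])
  moreover have "\<Phi> (compress F a)
      = (\<lambda>u v. \<Sum>p\<in>F \<times> F. a (fst p) (snd p) * \<Phi> (mat_unit (fst p) (snd p)) u v)"
    unfolding compress_as_sum[OF F] using F by (intro embedding_lincomb_units) auto
  ultimately show "\<Phi> (compress F a) = conj_amplify U (compress F a)" by (simp add: units)
qed

text \<open>An orthonormal basis of the range of $\Phi(e_{bb})$ whose expansion of the vectors
  $\Phi(e_{bx}) \delta_y$ is finite: it comes from applying Gram-Schmidt to these countably many vectors.\<close>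

lemma embedding_corner_basis:
  fixes b :: 'x
  assumes X: "countable (UNIV :: 'x set)" and Y: "countable (UNIV :: 'y set)"
  obtains w :: "nat \<Rightarrow> 'y \<Rightarrow> complex" and N where
    "\<And>m. l2 (w m)"
    "\<And>m n. m \<in> N \<Longrightarrow> n \<in> N \<Longrightarrow> cip (w m) (w n) = (if m = n then 1 else 0)"
    "\<And>m. mat_apply (\<Phi> (mat_unit b b)) (w m) = w m"
    "\<And>f x y. l2 f \<Longrightarrow> ((\<lambda>m. cip f (w m) * cip (w m) (mat_apply (\<Phi> (mat_unit b x)) (unit_vec y)))
        has_sum cip f (mat_apply (\<Phi> (mat_unit b x)) (unit_vec y))) N"
proof -
  have cXY: "countable (UNIV :: ('x \<times> 'y) set)"
    using countable_SIGMA[OF X Y] by (simp add: UNIV_Times_UNIV)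
  \<comment> \<open>All that matters is surjectivity. Values may repeat when the spaces are finite,
    and repeated vectors just produce zero residuals.\<close>
  define t :: "nat \<Rightarrow> 'x \<times> 'y" where "t = from_nat_into UNIV"
  have t: "range t = UNIV" unfolding t_def using cXY by (simp add: range_from_nat_into)
  define v where "v = (\<lambda>n. mat_apply (\<Phi> (mat_unit b (fst (t n)))) (unit_vec (snd (t n))))"
  have v: "l2 (v n)" for n
    unfolding v_def by (rule l2_mat_apply[OF embedding_bounded[OF uniform_roe_mat_unit] l2_unit_vec])
  have fix_v: "mat_apply (\<Phi> (mat_unit b b)) (v n) = v n" for n
    unfolding v_def by (simp add: embedding_unit_apply_apply[OF l2_unit_vec] del: mat_apply_unit_vec)
  define N where "N = {m. gram_schmidt v m \<noteq> (\<lambda>j. 0)}"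
  show ?thesis
  proof (rule that[of "gram_schmidt v" N])
    show "l2 (gram_schmidt v m)" for m by (rule l2_gram_schmidt[OF v])
    show "cip (gram_schmidt v m) (gram_schmidt v n) = (if m = n then 1 else 0)" if "m \<in> N" "n \<in> N" for m n
      using that gram_schmidt_norm[OF v] gram_schmidt_orthogonal[OF v] by (auto simp: N_def)
    show "mat_apply (\<Phi> (mat_unit b b)) (gram_schmidt v m) = gram_schmidt v m" for m
      by (rule gram_schmidt_fixed[OF v embedding_bounded[OF uniform_roe_mat_unit] fix_v])
    fix f :: "'y \<Rightarrow> complex" and x y assume f: "l2 f"
    obtain n where "t n = (x, y)" using t by (metis UNIV_I image_iff)
    then have "v n = mat_apply (\<Phi> (mat_unit b x)) (unit_vec y)" by (simp add: v_def)
    then show "((\<lambda>m. cip f (gram_schmidt v m) * cip (gram_schmidt v m) (mat_apply (\<Phi> (mat_unit b x)) (unit_vec y)))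
        has_sum cip f (mat_apply (\<Phi> (mat_unit b x)) (unit_vec y))) N"
      using gram_schmidt_parseval[of v f n, OF v f] by (simp add: N_def)
  qed
qed

text \<open>The rank at the single unit \<open>mat_unit b b\<close> forces the index set
  \<open>N\<close> of the corner basis to be equinumerous with \<open>'k\<close>. A bijection
  \<open>e\<close> then labels the columns of \<open>U\<close>.\<close>

lemma embedding_spatial:
  assumes X: "countable (UNIV :: 'x set)" and Y: "countable (UNIV :: 'y set)"
    and rank: "rank_preserving_1_to \<Phi> (if finite (UNIV :: 'k::countable set) then enat CARD('k) else \<infinity>)"
  shows "\<exists>U :: 'y \<Rightarrow> 'x \<times> 'k \<Rightarrow> complex. isometry_mat U \<and>
    (\<forall>x y. \<Phi> (mat_unit x y) = conj_amplify U (mat_unit x y))"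
proof -
  define b :: 'x where "b = undefined"
  let ?P = "\<lambda>x y. \<Phi> (mat_unit x y)"
  obtain w N where w: "\<And>m. l2 (w m)"
    and on: "\<And>m n. m \<in> N \<Longrightarrow> n \<in> N \<Longrightarrow> cip (w m) (w n) = (if m = n then 1 else 0)"
    and fixed: "\<And>m. mat_apply (?P b b) (w m) = w m"
    and parseval: "\<And>f x y. l2 f \<Longrightarrow> ((\<lambda>m. cip f (w m) * cip (w m) (mat_apply (?P b x) (unit_vec y)))
        has_sum cip f (mat_apply (?P b x) (unit_vec y))) (N :: nat set)"
    by (rule embedding_corner_basis[OF X Y, of b], rule that)
  note bP = embedding_bounded[OF uniform_roe_mat_unit]
  have rk: "has_rank (?P b b) (if finite (UNIV :: 'k set) then enat CARD('k) else \<infinity>)"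
    by (rule rank[unfolded rank_preserving_1_to_def, rule_format, OF conjI[OF uniform_roe_mat_unit has_rank_mat_unit]])
  have lower: "rank_at_least (?P b b) (card K)" if "finite K" "K \<subseteq> N" for K
    using that by (intro rank_at_least_orthonormal[of K w]) (auto simp: w on fixed subset_iff)
  have upper: "k \<le> card N" if N: "finite N" and rk': "rank_at_least (?P b b) k" for k
  proof -
    obtain f where f: "\<forall>m<k. l2 (f m)" and ind: "lin_indep_vecs (\<lambda>m. mat_apply (?P b b) (f m)) k"
      using rk' unfolding rank_at_least_def by blast
    \<comment> \<open>Entry \<open>j\<close> is the pairing of \<open>?u\<close> with
      \<open>g\<close>, and \<open>?u\<close> is the case \<open>x = b\<close> of the vectors that
      \<open>parseval\<close> covers. Hence the finite family over \<open>N\<close> spans the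
      range.\<close>
    have "mat_apply (?P b b) g j = (\<Sum>m\<in>N. cip (w m) g * w m j)" if g: "l2 g" for g j
    proof -
      let ?u = "mat_apply (?P b b) (unit_vec j)"
      have u: "l2 ?u" by (rule l2_mat_apply[OF bP l2_unit_vec])
      have "mat_apply (?P b b) g j = cip (unit_vec j) (mat_apply (?P b b) g)" by simp
      also have "\<dots> = cip ?u g" by (simp only: embedding_unit_cip[OF l2_unit_vec g])
      also have "\<dots> = cnj (cip g ?u)" by (rule cip_commute)
      also have "cip g ?u = (\<Sum>m\<in>N. cip g (w m) * cip (w m) ?u)"
        using parseval[OF g, of b j] N by (metis has_sum_finite has_sum_unique)
      also have "cnj \<dots> = (\<Sum>m\<in>N. cip (w m) g * w m j)"
      proof -
        have "cip ?u (w m) = w m j" for m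
          by (simp only: embedding_unit_cip[OF l2_unit_vec w] fixed cip_unit_vec)
        then show ?thesis by (simp only: cnj_sum complex_cnj_mult cip_commute[symmetric])
      qed
      finally show ?thesis .
    qed
    then have "\<And>m j. m < k \<Longrightarrow> mat_apply (?P b b) (f m) j = (\<Sum>l\<in>N. cip (w l) (f m) * w l j)"
      using f by blast
    then show ?thesis by (rule lin_indep_le_card_span[OF ind N])
  qed
  have "\<exists>e :: 'k \<Rightarrow> nat. bij_betw e UNIV N"
  proof (cases "finite N")
    case True
    have iff: "enat k \<le> (if finite (UNIV :: 'k set) then enat CARD('k) else \<infinity>) \<longleftrightarrow> k \<le> card N" for k
      using rk upper[OF True] lower[OF True] rank_at_least_mono unfolding has_rank_def by blast
    \<comment> \<open>Infinite rank would make the test at one more than \<open>card N\<close>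
      succeed.\<close>
    have fin: "finite (UNIV :: 'k set)" using iff[of "Suc (card N)"] by (auto split: if_splits)
    have "CARD('k) = card N" using iff[of "CARD('k)"] iff[of "card N"] fin by simp
    then show ?thesis using fin True finite_same_card_bij by blast
  next
    case False
    have "rank_at_least (?P b b) k" for k
      using infinite_arbitrarily_large[OF False, of k] lower by auto
    \<comment> \<open>The test value exceeds \<open>CARD('k)\<close> by one, so it can succeed only
      on the infinite branch.\<close>
    then have "enat (Suc CARD('k)) \<le> (if finite (UNIV :: 'k set) then enat CARD('k) else \<infinity>)"
      using rk unfolding has_rank_def by blast
    then have inf: "infinite (UNIV :: 'k set)" by (auto split: if_splits)
    \<comment> \<open>Both the countable type \<open>'k\<close> and the set \<open>N\<close> are
      infinite, so each is matched with the natural numbers.\<close>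
    have "bij_betw (to_nat_on (UNIV :: 'k set)) UNIV (UNIV :: nat set)"
      using inf by (intro to_nat_on_infinite) auto
    moreover have "bij_betw (from_nat_into N) UNIV N"
      using False by (intro bij_betw_from_nat_into) auto
    ultimately show ?thesis using bij_betw_trans by blast
  qed
  then obtain e :: "'k \<Rightarrow> nat" where e: "bij_betw e UNIV N" by blast
  have eN: "e k \<in> N" for k using e by (auto simp: bij_betw_def)
  have e_inj: "e k = e l \<longleftrightarrow> k = l" for k l using e by (auto simp: bij_betw_def inj_on_def)
  define U :: "'y \<Rightarrow> 'x \<times> 'k \<Rightarrow> complex" where "U = (\<lambda>y (x, k). mat_apply (?P x b) (w (e k)) y)"
  have col: "(\<lambda>y. U y (x, k)) = mat_apply (?P x b) (w (e k))" for x k by (simp add: U_def)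
  have iso: "isometry_mat U"
  proof (rule isometry_orthonormal_columns)
    show "l2 (\<lambda>j. U j i)" for i
      by (cases i) (simp add: col l2_mat_apply bP w)
    show "cip (\<lambda>j. U j i) (\<lambda>j. U j i') = (if i = i' then 1 else 0)" for i i'
      by (cases i; cases i') (auto simp: col embedding_unit_cip_cip w fixed on eN e_inj)
  qed
  moreover have "?P x x' = conj_amplify U (mat_unit x x')" for x x'
  proof (intro ext)
    fix y y'
    let ?a = "mat_apply (?P b x) (unit_vec y)" and ?b = "mat_apply (?P b x') (unit_vec y')"
    have a: "l2 ?a" by (rule l2_mat_apply[OF bP l2_unit_vec])
    \<comment> \<open>Moving \<open>?P t b\<close> to the other side writes each entry of
      \<open>U\<close> as a coefficient against the basis. The entry series of the conjugated unit
      thereby becomes the Parseval series for \<open>?a\<close> and \<open>?b\<close>.\<close>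
    have row: "U z (t, k) = cip (mat_apply (?P b t) (unit_vec z)) (w (e k))" for z t k
      by (simp only: embedding_unit_cip[OF l2_unit_vec w] cip_unit_vec U_def prod.case)
    have "conj_amplify U (mat_unit x x') y y' = (\<Sum>\<^sub>\<infinity>k. cip ?a (w (e k)) * cip (w (e k)) ?b)"
      unfolding conj_amplify_mat_unit[OF isometry_bounded[OF iso]] row
      by (simp only: cip_commute[symmetric])
    also have "\<dots> = infsum (\<lambda>m. cip ?a (w m) * cip (w m) ?b) N"
      by (rule infsum_reindex_bij_betw[OF e])
    also have "\<dots> = cip ?a ?b" by (rule infsumI[OF parseval[OF a]])
    also have "\<dots> = ?P x x' y y'"
      unfolding embedding_unit_cip_cip[OF l2_unit_vec l2_unit_vec] by simp
    finally show "?P x x' y y' = conj_amplify U (mat_unit x x') y y'" by simp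
  qed
  ultimately show ?thesis by blast
qed

end

theorem theorem5p5:
  fixes \<Phi> :: "('x::metric_space \<Rightarrow> 'x \<Rightarrow> complex) \<Rightarrow> ('y::metric_space \<Rightarrow> 'y \<Rightarrow> complex)"
  assumes "unif_locally_finite TYPE('x)"
    and "unif_locally_finite TYPE('y)"
    and "roe_embedding \<Phi>"
  shows "(\<exists>U :: 'y \<Rightarrow> ('x \<times> 'k::countable) \<Rightarrow> complex.
            isometry_mat U \<and>
            (\<forall>a. uniform_roe a \<longrightarrow> \<Phi> a = mat_mult (mat_mult U (amplify a)) (mat_adj U)))
         \<longleftrightarrow>
         (rank_preserving_1_to \<Phi> (if finite (UNIV :: 'k set) then enat CARD('k) else \<infinity>)
          \<and> strongly_continuous \<Phi>)"
  (is "?spatial \<longleftrightarrow> ?rank \<and> ?cont")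
proof
  assume ?spatial
  then obtain U :: "'y \<Rightarrow> 'x \<times> 'k \<Rightarrow> complex" where U: "isometry_mat U"
    and \<Phi>: "\<And>a. uniform_roe a \<Longrightarrow> \<Phi> a = conj_amplify U a"
    unfolding conj_amplify_def by blast
  have ?rank
    unfolding rank_preserving_1_to_def
    using conj_amplify_has_rank[OF U uniform_roe_bounded] \<Phi> by metis
  \<comment> \<open>Strong continuity evaluates a map only at members of the algebra, where
    \<open>\<Phi>\<close> and \<open>conj_amplify U\<close> coincide; the congruence rules make the
    membership available for rewriting.\<close>
  moreover have ?cont
    using conj_amplify_strongly_continuous[OF U] unfolding strongly_continuous_def
    by (simp add: \<Phi> cong: conj_cong imp_cong)
  ultimately show "?rank \<and> ?cont" ..
next
  assume "?rank \<and> ?cont"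
  then obtain U :: "'y \<Rightarrow> 'x \<times> 'k \<Rightarrow> complex" where U: "isometry_mat U"
    and units: "\<And>x y. \<Phi> (mat_unit x y) = conj_amplify U (mat_unit x y)"
    using embedding_spatial[OF assms(3) assms(1,2)[THEN unif_locally_finite_countable], where 'k='k] by blast
  have "\<Phi> a = conj_amplify U a" if "uniform_roe a" for a
    using embedding_eq_conj_amplify[OF assms(3) _ U units that] \<open>?rank \<and> ?cont\<close> by blast
  with U show ?spatial unfolding conj_amplify_def by blast
qed

end
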